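(* Let an explicit $s$-stage Runge--Kutta method with operator $R_s=\sum_{k=0}^s\alpha_k(\tau L)^k$ be given, let $k^*$ be its leading index, $\beta_{k^*}$ its leading coefficient and $\Gamma^*$ its leading submatrix. If $\beta_{k^*}<0$ and $\Gamma^*$ is negative definite, then there exists a constant $\lambda>0$ such that $\|R_s\|_H\le 1$ whenever $\tau\|L\|_H\le\lambda$ and $L$ is semi-negative, i.e. $L^\top H+HL\le0$.
   Context: An explicit $s$-stage Runge--Kutta (RK) method ($s\ge 1$) applied to the linear autonomous system $\frac{d}{dt}u=Lu$, $u\in\mathbb{R}^N$, $L\in\mathbb{R}^{N\times N}$, with time step $\tau>0$ takes the form $u^{n+1}=R_s u^n$, where $R_s=\sum_{k=0}^s\alpha_k(\tau L)^k$ with real coefficients $\alpha_k$ depending only on the method, $\alpha_0=1$, $\alpha_s\ne 0$. For a real symmetric positive definite $N\times N$ matrix $H$, let $\langle v,w\rangle_H=\langle v,Hw\rangle$ ($\langle\cdot,\cdot\rangle$ the Euclidean inner product), $\|v\|_H=\sqrt{\langle v,v\rangle_H}$, and let $\|A\|_H$ be the induced operator norm of a matrix $A$. $L$ is semi-negative (with respect to $H$) if $L^\top H+HL\le 0$, i.e. is negative semi-definite. For semi-negative $L$ put $[v,w]_H=-\langle v,(L^\top H+HL)w\rangle$ (a semi inner product). The constant $\lambda$ depends only on the method. Energy equality: there are unique real coefficients $\{\beta_k\}_{k=0}^s$ and $\{\gamma_{i,j}\}_{i,j=0}^{s-1}$ with $\gamma_{i,j}=\gamma_{j,i}$, depending only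 on $\alpha_0,\dots,\alpha_s$, such that for all $N$, $H$ symmetric positive definite, $L$ semi-negative with respect to $H$, $u\in\mathbb{R}^N$ and $\tau$, $$\|R_su\|_H^2=\sum_{k=0}^s\beta_k\tau^{2k}\|L^ku\|_H^2+\sum_{i,j=0}^{s-1}\gamma_{i,j}\tau^{i+j+1}[L^iu,L^ju]_H .$$ The leading index $k^*$ is the positive integer with $\beta_{k^*}\ne0$ and $\beta_k=0$ for all $1\le k<k^*$ (it exists and $k^*\le s$, since $\beta_s=\alpha_s^2\neq0$). $\beta_{k^*}$ is called the leading coefficient, and the $k^*\times k^*$ matrix $\Gamma^*=(\gamma_{i,j})_{0\le i,j\le k^*-1}$ the leading submatrix. *)

theory Defs
  imports Complex_Main "HOL-Computational_Algebra.Polynomial" "Jordan_Normal_Form.Matrix"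
begin

section \<open>Definite matrices and the H-weighted Euclidean space\<close>

definition pos_def :: "nat \<Rightarrow> real mat \<Rightarrow> bool" where
  "pos_def n A \<longleftrightarrow> A \<in> carrier_mat n n \<and> transpose_mat A = A \<and>
     (\<forall>v \<in> carrier_vec n. v \<noteq> 0\<^sub>v n \<longrightarrow> v \<bullet> (A *\<^sub>v v) > 0)"

definition neg_def :: "nat \<Rightarrow> real mat \<Rightarrow> bool" where
  "neg_def n A \<longleftrightarrow> A \<in> carrier_mat n n \<and> transpose_mat A = A \<and>
     (\<forall>v \<in> carrier_vec n. v \<noteq> 0\<^sub>v n \<longrightarrow> v \<bullet> (A *\<^sub>v v) < 0)"

definition neg_semidef :: "nat \<Rightarrow> real mat \<Rightarrow> bool" where
  "neg_semidef n A \<longleftrightarrow> A \<in> carrier_mat n n \<and> transpose_mat A = A \<and>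
     (\<forall>v \<in> carrier_vec n. v \<bullet> (A *\<^sub>v v) \<le> 0)"

definition inner_H :: "real mat \<Rightarrow> real vec \<Rightarrow> real vec \<Rightarrow> real" where
  "inner_H H v w = v \<bullet> (H *\<^sub>v w)"

definition norm_H :: "real mat \<Rightarrow> real vec \<Rightarrow> real" where
  "norm_H H v = sqrt (inner_H H v v)"

text \<open>The induced operator norm, with the convention of \<open>onorm\<close> in HOL-Analysis: the vector
  \<open>v = 0\<close> contributes \<open>0 / 0 = 0\<close>.  When \<open>H\<close> is positive definite the supremum is over
  a bounded set, so it is a genuine supremum.\<close>

definition opnorm_H :: "real mat \<Rightarrow> real mat \<Rightarrow> real" where
  "opnorm_H H A = (SUP v \<in> carrier_vec (dim_row H). norm_H H (A *\<^sub>v v) / norm_H H v)"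

definition semi_negative :: "nat \<Rightarrow> real mat \<Rightarrow> real mat \<Rightarrow> bool" where
  "semi_negative N H L \<longleftrightarrow> L \<in> carrier_mat N N \<and> neg_semidef N (transpose_mat L * H + H * L)"

definition bracket_H :: "real mat \<Rightarrow> real mat \<Rightarrow> real vec \<Rightarrow> real vec \<Rightarrow> real" where
  "bracket_H H L v w = - (v \<bullet> ((transpose_mat L * H + H * L) *\<^sub>v w))"

section \<open>Explicit Runge--Kutta operators and the energy equality\<close>

definition explicit_rk :: "nat \<Rightarrow> (nat \<Rightarrow> real) \<Rightarrow> bool" where
  "explicit_rk s \<alpha> \<longleftrightarrow> s \<ge> 1 \<and> \<alpha> 0 = 1 \<and> \<alpha> s \<noteq> 0"

text \<open>The matrix \<open>\<Sum>k\<le>s. \<alpha> k (\<tau> L)^k\<close>.  Matrices of variable size do not form an additive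
  monoid type, so the sum is taken entrywise.\<close>

definition rk_op :: "nat \<Rightarrow> (nat \<Rightarrow> real) \<Rightarrow> real \<Rightarrow> real mat \<Rightarrow> real mat" where
  "rk_op s \<alpha> \<tau> L = mat (dim_row L) (dim_row L)
     (\<lambda>ij. \<Sum>k\<le>s. (\<alpha> k \<cdot>\<^sub>m ((\<tau> \<cdot>\<^sub>m L) ^\<^sub>m k)) $$ ij)"

text \<open>\<open>\<beta>\<close> and \<open>\<gamma>\<close> are the coefficients of the energy equality of the method \<open>\<alpha>\<close>.  Only
  \<open>\<beta> k\<close> for \<open>k \<le> s\<close> and \<open>\<gamma> i j\<close> for \<open>i, j < s\<close> are meaningful; that these exist and
  are unique is shown below.\<close>

definition energy_coeffs ::
    "nat \<Rightarrow> (nat \<Rightarrow> real) \<Rightarrow> (nat \<Rightarrow> real) \<Rightarrow> (nat \<Rightarrow> nat \<Rightarrow> real) \<Rightarrow> bool" where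
  "energy_coeffs s \<alpha> \<beta> \<gamma> \<longleftrightarrow>
     (\<forall>i<s. \<forall>j<s. \<gamma> i j = \<gamma> j i) \<and>
     (\<forall>N H L u \<tau>. pos_def N H \<longrightarrow> semi_negative N H L \<longrightarrow> u \<in> carrier_vec N \<longrightarrow> \<tau> > 0 \<longrightarrow>
        (norm_H H (rk_op s \<alpha> \<tau> L *\<^sub>v u))\<^sup>2 =
          (\<Sum>k\<le>s. \<beta> k * \<tau> ^ (2 * k) * (norm_H H ((L ^\<^sub>m k) *\<^sub>v u))\<^sup>2) +
          (\<Sum>i<s. \<Sum>j<s. \<gamma> i j * \<tau> ^ (i + j + 1) *
             bracket_H H L ((L ^\<^sub>m i) *\<^sub>v u) ((L ^\<^sub>m j) *\<^sub>v u)))"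

definition leading_index :: "nat \<Rightarrow> (nat \<Rightarrow> real) \<Rightarrow> nat \<Rightarrow> bool" where
  "leading_index s \<beta> k \<longleftrightarrow> 1 \<le> k \<and> k \<le> s \<and> \<beta> k \<noteq> 0 \<and> (\<forall>j. 1 \<le> j \<and> j < k \<longrightarrow> \<beta> j = 0)"

definition leading_submatrix :: "nat \<Rightarrow> (nat \<Rightarrow> nat \<Rightarrow> real) \<Rightarrow> real mat" where
  "leading_submatrix k \<gamma> = mat k k (\<lambda>(i, j). \<gamma> i j)"

section \<open>Existence and uniqueness of the coefficients\<close>

text \<open>Existence only uses that \<open>B i j\<close>, standing for \<open>\<tau>^(i+j) \<langle>L^i u, L^j u\<rangle>\<^sub>H\<close>, and
  \<open>S i j\<close>, standing for \<open>\<tau>^(i+j+1) [L^i u, L^j u]\<^sub>H\<close>, are related as follows.\<close>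

definition energy_rel :: "(nat \<Rightarrow> nat \<Rightarrow> real) \<Rightarrow> (nat \<Rightarrow> nat \<Rightarrow> real) \<Rightarrow> bool" where
  "energy_rel B S \<longleftrightarrow> (\<forall>i j. B i j = B j i \<and> S i j = S j i \<and>
     B (Suc i) j + B i (Suc j) = - S i j)"

definition expressible ::
    "nat \<Rightarrow> ((nat \<Rightarrow> nat \<Rightarrow> real) \<Rightarrow> (nat \<Rightarrow> nat \<Rightarrow> real) \<Rightarrow> real) \<Rightarrow> bool" where
  "expressible s f \<longleftrightarrow> (\<exists>b g. \<forall>B S. energy_rel B S \<longrightarrow>
     f B S = (\<Sum>k\<le>s. b k * B k k) + (\<Sum>i<s. \<Sum>j<s. g i j * S i j))"

lemma expressible_add:
  assumes "expressible s f" "expressible s f'"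
  shows "expressible s (\<lambda>B S. f B S + f' B S)"
proof -
  obtain b g where 1: "\<And>B S. energy_rel B S \<Longrightarrow>
     f B S = (\<Sum>k\<le>s. b k * B k k) + (\<Sum>i<s. \<Sum>j<s. g i j * S i j)"
    using assms(1) unfolding expressible_def by blast
  obtain b' g' where 2: "\<And>B S. energy_rel B S \<Longrightarrow>
     f' B S = (\<Sum>k\<le>s. b' k * B k k) + (\<Sum>i<s. \<Sum>j<s. g' i j * S i j)"
    using assms(2) unfolding expressible_def by blast
  show ?thesis unfolding expressible_def
    by (rule exI[of _ "\<lambda>k. b k + b' k"], rule exI[of _ "\<lambda>i j. g i j + g' i j"])
       (simp add: 1 2 algebra_simps sum.distrib)
qed

lemma expressible_scale:
  assumes "expressible s f"
  shows "expressible s (\<lambda>B S. c * f B S)"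
proof -
  obtain b g where 1: "\<And>B S. energy_rel B S \<Longrightarrow>
     f B S = (\<Sum>k\<le>s. b k * B k k) + (\<Sum>i<s. \<Sum>j<s. g i j * S i j)"
    using assms(1) unfolding expressible_def by blast
  show ?thesis unfolding expressible_def
    by (rule exI[of _ "\<lambda>k. c * b k"], rule exI[of _ "\<lambda>i j. c * g i j"])
       (simp add: 1 algebra_simps sum_distrib_left)
qed

lemma expressible_sum:
  assumes "finite A" "\<And>x. x \<in> A \<Longrightarrow> expressible s (f x)"
  shows "expressible s (\<lambda>B S. \<Sum>x\<in>A. f x B S)"
  using assms
proof (induction A rule: finite_induct)
  case empty
  show ?case unfolding expressible_def
    by (rule exI[of _ "\<lambda>k. 0"], rule exI[of _ "\<lambda>i j. 0"]) simp
next
  case (insert x F)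
  then show ?case using expressible_add[of s "f x" "\<lambda>B S. \<Sum>x\<in>F. f x B S"] by simp
qed

lemma expressible_cong:
  assumes "expressible s f" "\<And>B S. energy_rel B S \<Longrightarrow> f' B S = f B S"
  shows "expressible s f'"
  using assms unfolding expressible_def by simp

lemma expressible_S:
  assumes "i < s" "j < s"
  shows "expressible s (\<lambda>B S. S i j)"
  unfolding expressible_def
proof (rule exI[of _ "\<lambda>k. 0"], rule exI[of _ "\<lambda>i' j'. if i' = i then if j' = j then 1 else 0 else 0"],
    intro allI impI)
  fix B S :: "nat \<Rightarrow> nat \<Rightarrow> real"
  have "(\<Sum>i'<s. \<Sum>j'<s. (if i' = i then if j' = j then 1 else 0 else 0) * S i' j') =
     (\<Sum>i'<s. if i' = i then (\<Sum>j'<s. if j' = j then S i' j' else 0) else 0)"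
    by (intro sum.cong refl) (simp add: if_distrib[of "\<lambda>z. z * _"] cong: if_cong)
  also have "\<dots> = S i j" using assms by simp
  finally show "S i j = (\<Sum>k\<le>s. 0 * B k k) +
     (\<Sum>i'<s. \<Sum>j'<s. (if i' = i then if j' = j then 1 else 0 else 0) * S i' j')"
    by (metis (no_types, lifting) add_0 mult_zero_left sum.neutral)
qed

lemma expressible_B_le:
  assumes "i + d \<le> s"
  shows "expressible s (\<lambda>B S. B i (i + d))"
  using assms
proof (induction d arbitrary: i rule: less_induct)
  case (less d)
  consider "d = 0" | "d = 1" | e where "d = Suc (Suc e)"
    by (metis One_nat_def not0_implies_Suc)
  then show ?case
  proof cases
    case 1
    show ?thesis unfolding expressible_def
    proof (rule exI[of _ "\<lambda>k. if k = i then 1 else 0"], rule exI[of _ "\<lambda>i j. 0"], intro allI impI)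
      fix B S :: "nat \<Rightarrow> nat \<Rightarrow> real"
      have "(\<Sum>k\<le>s. (if k = i then 1 else 0) * B k k) = (\<Sum>k\<le>s. if k = i then B k k else 0)"
        by (intro sum.cong) auto
      then show "B i (i + d) = (\<Sum>k\<le>s. (if k = i then 1 else 0) * B k k) + (\<Sum>i<s. \<Sum>j<s. 0 * S i j)"
        using less.prems 1 by simp
    qed
  next
    case 2
    have "expressible s (\<lambda>B S. (-1/2) * S i i)"
      using less.prems 2 by (intro expressible_scale expressible_S) auto
    then show ?thesis
    proof (rule expressible_cong)
      fix B S assume "energy_rel B S"
      then have "B (Suc i) i + B i (Suc i) = - S i i" "B (Suc i) i = B i (Suc i)"
        unfolding energy_rel_def by blast+
      then show "B i (i + d) = (-1/2) * S i i" using 2 by simp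
    qed
  next
    case 3
    have "expressible s (\<lambda>B S. (-1) * B (Suc i) (Suc i + e) + (-1) * S i (i + d - 1))"
      using less.prems 3
      by (intro expressible_add expressible_scale expressible_S less.IH) auto
    then show ?thesis
    proof (rule expressible_cong)
      fix B S assume "energy_rel B S"
      then have "B (Suc i) (Suc i + e) + B i (Suc (Suc i + e)) = - S i (Suc i + e)"
        unfolding energy_rel_def by blast
      then show "B i (i + d) = (-1) * B (Suc i) (Suc i + e) + (-1) * S i (i + d - 1)"
        using 3 by simp
    qed
  qed
qed

lemma expressible_B:
  assumes "i \<le> s" "j \<le> s"
  shows "expressible s (\<lambda>B S. B i j)"
proof (cases "i \<le> j")
  case True
  then show ?thesis using expressible_B_le[of i "j - i" s] assms by simp
next
  case False
  then have "expressible s (\<lambda>B S. B j i)" using expressible_B_le[of j "i - j" s] assms by simp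
  then show ?thesis by (rule expressible_cong) (auto simp: energy_rel_def)
qed

lemma pow_smult_mat:
  fixes L :: "real mat"
  assumes "L \<in> carrier_mat N N"
  shows "(\<tau> \<cdot>\<^sub>m L) ^\<^sub>m k = \<tau> ^ k \<cdot>\<^sub>m (L ^\<^sub>m k)"
proof (induction k)
  case 0
  then show ?case using assms by auto
next
  case (Suc k)
  have P: "L ^\<^sub>m k \<in> carrier_mat N N" using assms by simp
  show ?case using Suc assms P
    by (auto simp: mult_smult_distrib[of _ N N _ N] mult_smult_assoc_mat[of _ N N _ N] ac_simps)
qed

lemma rk_op_mult_vec:
  assumes L: "L \<in> carrier_mat N N" and u: "u \<in> carrier_vec N"
  shows "rk_op s \<alpha> \<tau> L *\<^sub>v u =
    vec N (\<lambda>n. \<Sum>k\<le>s. \<alpha> k * \<tau> ^ k * ((L ^\<^sub>m k) *\<^sub>v u) $ n)"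
proof (rule eq_vecI)
  fix n assume "n < dim_vec (vec N (\<lambda>n. \<Sum>k\<le>s. \<alpha> k * \<tau> ^ k * ((L ^\<^sub>m k) *\<^sub>v u) $ n))"
  then have n: "n < N" by simp
  have d: "dim_row (L ^\<^sub>m k) = N" "dim_col (L ^\<^sub>m k) = N" for k
    using L by (auto simp: pow_mat_dim_square)
  have "(rk_op s \<alpha> \<tau> L *\<^sub>v u) $ n =
     (\<Sum>m<N. (\<Sum>k\<le>s. \<alpha> k * \<tau> ^ k * (L ^\<^sub>m k) $$ (n, m)) * u $ m)"
    using n L u d by (auto simp: rk_op_def pow_smult_mat[OF L] scalar_prod_def atLeast0LessThan
        ac_simps intro!: sum.cong)
  also have "\<dots> = (\<Sum>k\<le>s. \<Sum>m<N. \<alpha> k * \<tau> ^ k * (L ^\<^sub>m k) $$ (n, m) * u $ m)"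
    by (subst sum.swap) (simp add: sum_distrib_right)
  also have "\<dots> = (\<Sum>k\<le>s. \<alpha> k * \<tau> ^ k * ((L ^\<^sub>m k) *\<^sub>v u) $ n)"
    using n u d by (auto simp: scalar_prod_def atLeast0LessThan sum_distrib_left ac_simps
        intro!: sum.cong)
  finally show "(rk_op s \<alpha> \<tau> L *\<^sub>v u) $ n =
      vec N (\<lambda>n. \<Sum>k\<le>s. \<alpha> k * \<tau> ^ k * ((L ^\<^sub>m k) *\<^sub>v u) $ n) $ n" using n by simp
qed (use L in \<open>auto simp: rk_op_def\<close>)

lemma inner_H_sums:
  assumes "H \<in> carrier_mat N N"  "v \<in> carrier_vec N" "w \<in> carrier_vec N"
  shows "inner_H H v w = (\<Sum>m<N. \<Sum>n<N. H $$ (m, n) * (v $ m * w $ n))"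
  using assms by (auto simp: inner_H_def scalar_prod_def atLeast0LessThan sum_distrib_left ac_simps
      intro!: sum.cong)

lemma inner_H_commute:
  assumes "H \<in> carrier_mat N N" "transpose_mat H = H" "v \<in> carrier_vec N" "w \<in> carrier_vec N"
  shows "inner_H H v w = inner_H H w v"
proof -
  have s: "H $$ (m, n) = H $$ (n, m)" if "m < N" "n < N" for m n
    using that assms(1,2) by (metis carrier_matD index_transpose_mat(1))
  have "inner_H H v w = (\<Sum>m<N. \<Sum>n<N. H $$ (n, m) * (w $ n * v $ m))"
    unfolding inner_H_sums[OF assms(1,3,4)]
    by (intro sum.cong refl) (simp add: s mult.commute)
  also have "\<dots> = inner_H H w v"
    unfolding inner_H_sums[OF assms(1,4,3)] by (rule sum.swap)
  finally show ?thesis .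
qed

lemma norm_H_square:
  assumes "pos_def N H" "v \<in> carrier_vec N"
  shows "(norm_H H v)\<^sup>2 = inner_H H v v"
proof (cases "v = 0\<^sub>v N")
  case True
  then show ?thesis using assms by (auto simp: norm_H_def inner_H_def pos_def_def)
next
  case False
  then have "inner_H H v v > 0" using assms by (auto simp: pos_def_def inner_H_def)
  then show ?thesis by (simp add: norm_H_def)
qed

lemma bracket_H_eq:
  assumes H: "H \<in> carrier_mat N N" and L: "L \<in> carrier_mat N N"
    and v: "v \<in> carrier_vec N" and w: "w \<in> carrier_vec N"
  shows "bracket_H H L v w = - (inner_H H (L *\<^sub>v v) w + inner_H H v (L *\<^sub>v w))"
proof -
  have 1: "(transpose_mat L * H + H * L) *\<^sub>v w = transpose_mat L *\<^sub>v (H *\<^sub>v w) + H *\<^sub>v (L *\<^sub>v w)"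
    using assms by (subst add_mult_distrib_mat_vec[of _ N N]) auto
  have 2: "v \<bullet> (transpose_mat L *\<^sub>v (H *\<^sub>v w)) = (L *\<^sub>v v) \<bullet> (H *\<^sub>v w)"
  proof -
    have "(transpose_mat L *\<^sub>v (H *\<^sub>v w)) \<bullet> v = (H *\<^sub>v w) \<bullet> (L *\<^sub>v v)"
      by (rule transpose_vec_mult_scalar[OF L v]) (use H w in simp)
    moreover have "(transpose_mat L *\<^sub>v (H *\<^sub>v w)) \<bullet> v = v \<bullet> (transpose_mat L *\<^sub>v (H *\<^sub>v w))"
      by (rule comm_scalar_prod[of _ N]) (use assms in simp_all)
    moreover have "(H *\<^sub>v w) \<bullet> (L *\<^sub>v v) = (L *\<^sub>v v) \<bullet> (H *\<^sub>v w)"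
      by (rule comm_scalar_prod[of _ N]) (use assms in simp_all)
    ultimately show ?thesis by simp
  qed
  show ?thesis unfolding bracket_H_def inner_H_def 1
    using assms 2 by (subst scalar_prod_add_distrib[of _ N]) auto
qed

lemma pow_mat_Suc_left:
  assumes "(L :: real mat) \<in> carrier_mat N N" "u \<in> carrier_vec N"
  shows "(L ^\<^sub>m Suc k) *\<^sub>v u = L *\<^sub>v ((L ^\<^sub>m k) *\<^sub>v u)"
proof -
  have "L ^\<^sub>m Suc k = L * L ^\<^sub>m k"
  proof (induction k)
    case (Suc k)
    have "L ^\<^sub>m k \<in> carrier_mat N N" using assms by simp
    then show ?case using Suc assms by (simp add: assoc_mult_mat[of _ N N _ N _ N])
  qed (use assms in simp)
  moreover have "L ^\<^sub>m k \<in> carrier_mat N N" using assms by simp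
  ultimately show ?thesis using assms by (simp add: assoc_mult_mat_vec[of _ N N _ N])
qed

theorem energy_coeffs_exist: "\<exists>\<beta> \<gamma>. energy_coeffs s \<alpha> \<beta> \<gamma>"
proof -
  have "expressible s (\<lambda>B S. \<Sum>i\<le>s. \<Sum>j\<le>s. (\<alpha> i * \<alpha> j) * B i j)"
    by (intro expressible_sum expressible_scale expressible_B) auto
  then obtain b g where bg: "\<And>B S. energy_rel B S \<Longrightarrow>
     (\<Sum>i\<le>s. \<Sum>j\<le>s. (\<alpha> i * \<alpha> j) * B i j) = (\<Sum>k\<le>s. b k * B k k) + (\<Sum>i<s. \<Sum>j<s. g i j * S i j)"
    unfolding expressible_def by blast
  define \<gamma> where "\<gamma> i j = (g i j + g j i) / 2" for i j
  have "energy_coeffs s \<alpha> b \<gamma>"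
    unfolding energy_coeffs_def
  proof (intro conjI allI impI)
    fix N and H L :: "real mat" and u :: "real vec" and \<tau> :: real
    assume H: "pos_def N H" and L: "semi_negative N H L" and u: "u \<in> carrier_vec N"
    have Hc: "H \<in> carrier_mat N N" "transpose_mat H = H" and Lc: "L \<in> carrier_mat N N"
      using H L by (auto simp: pos_def_def semi_negative_def)
    define x where "x k = (L ^\<^sub>m k) *\<^sub>v u" for k
    have xc: "x k \<in> carrier_vec N" for k
      unfolding x_def using Lc u by (meson mult_mat_vec_carrier pow_carrier_mat)
    have xS: "L *\<^sub>v x k = x (Suc k)" for k
      unfolding x_def using pow_mat_Suc_left[OF Lc u] by simp
    define B where "B i j = \<tau> ^ (i + j) * inner_H H (x i) (x j)" for i j
    define S where "S i j = \<tau> ^ (i + j + 1) * bracket_H H L (x i) (x j)" for i j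
    have br: "bracket_H H L (x i) (x j) =
       - (inner_H H (x (Suc i)) (x j) + inner_H H (x i) (x (Suc j)))" for i j
      by (simp add: bracket_H_eq[OF Hc(1) Lc xc xc] xS)
    have com: "inner_H H (x i) (x j) = inner_H H (x j) (x i)" for i j
      by (rule inner_H_commute[OF Hc xc xc])
    have rel: "energy_rel B S"
      unfolding energy_rel_def
    proof (intro allI conjI)
      fix i j
      show "B i j = B j i" unfolding B_def by (simp add: com add.commute)
      show "S i j = S j i" unfolding S_def br using com[of "Suc i" j] com[of i "Suc j"]
        by (simp add: add.commute)
      show "B (Suc i) j + B i (Suc j) = - S i j" unfolding B_def S_def br
        by (simp add: algebra_simps)
    qed
    have "(norm_H H (rk_op s \<alpha> \<tau> L *\<^sub>v u))\<^sup>2 =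
       (\<Sum>m<N. \<Sum>n<N. H $$ (m, n) * ((\<Sum>i\<le>s. \<alpha> i * \<tau> ^ i * x i $ m) * (\<Sum>j\<le>s. \<alpha> j * \<tau> ^ j * x j $ n)))"
      unfolding rk_op_mult_vec[OF Lc u]
      by (subst norm_H_square[OF H]) (auto simp: inner_H_sums[OF Hc(1)] x_def intro!: sum.cong)
    also have "\<dots> = (\<Sum>m<N. \<Sum>n<N. \<Sum>i\<le>s. \<Sum>j\<le>s. \<alpha> i * \<alpha> j * (\<tau> ^ (i + j) * (H $$ (m, n) * (x i $ m * x j $ n))))"
      by (intro sum.cong refl, subst sum_product)
         (simp add: sum_distrib_left power_add ac_simps)
    also have "\<dots> = (\<Sum>i\<le>s. \<Sum>j\<le>s. \<Sum>m<N. \<Sum>n<N. \<alpha> i * \<alpha> j * (\<tau> ^ (i + j) * (H $$ (m, n) * (x i $ m * x j $ n))))"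
      by (simp only: sum.swap[of _ "{..s}" "{..<N}"])
    also have "\<dots> = (\<Sum>i\<le>s. \<Sum>j\<le>s. (\<alpha> i * \<alpha> j) * B i j)"
      unfolding B_def inner_H_sums[OF Hc(1) xc xc] by (simp add: sum_distrib_left)
    also have "\<dots> = (\<Sum>k\<le>s. b k * B k k) + (\<Sum>i<s. \<Sum>j<s. g i j * S i j)"
      by (rule bg[OF rel])
    also have "(\<Sum>i<s. \<Sum>j<s. g i j * S i j) = (\<Sum>i<s. \<Sum>j<s. \<gamma> i j * S i j)"
    proof -
      have "(\<Sum>i<s. \<Sum>j<s. g i j * S i j) = (\<Sum>i<s. \<Sum>j<s. g j i * S i j)"
        using rel by (subst sum.swap) (auto simp: energy_rel_def intro!: sum.cong)
      moreover have "(\<Sum>i<s. \<Sum>j<s. \<gamma> i j * S i j) =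
          ((\<Sum>i<s. \<Sum>j<s. g i j * S i j) + (\<Sum>i<s. \<Sum>j<s. g j i * S i j)) / 2"
        unfolding \<gamma>_def
        by (simp add: sum.distrib sum_divide_distrib add_divide_distrib distrib_right)
      ultimately show ?thesis by simp
    qed
    finally show "(norm_H H (rk_op s \<alpha> \<tau> L *\<^sub>v u))\<^sup>2 =
          (\<Sum>k\<le>s. b k * \<tau> ^ (2 * k) * (norm_H H ((L ^\<^sub>m k) *\<^sub>v u))\<^sup>2) +
          (\<Sum>i<s. \<Sum>j<s. \<gamma> i j * \<tau> ^ (i + j + 1) *
             bracket_H H L ((L ^\<^sub>m i) *\<^sub>v u) ((L ^\<^sub>m j) *\<^sub>v u))"
      unfolding B_def S_def x_def[symmetric]
      by (simp add: norm_H_square[OF H xc] mult.assoc mult_2)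
  qed (simp add: \<gamma>_def)
  then show ?thesis by blast
qed

text \<open>For uniqueness take \<open>L = diag a b\<close> with \<open>a, b < 0\<close>, \<open>u = (1, \<plusminus>1)\<close> and
  \<open>H = (1, c; c, 1)\<close> with \<open>c > 0\<close> so small that \<open>L\<close> is semi-negative.\<close>

lemma sum_lessThan_2: "(\<Sum>i = 0..<2. f i) = f 0 + f (Suc 0)" for f :: "nat \<Rightarrow> real"
  by (simp add: numeral_2_eq_2)

lemma energy_coeffs_test:
  assumes E: "energy_coeffs s \<alpha> \<beta> \<gamma>" and E': "energy_coeffs s \<alpha> \<beta>' \<gamma>'"
    and a: "a < 0" and b: "b < (0 :: real)"
  shows "(\<Sum>k\<le>s. (\<beta> k - \<beta>' k) * (a * b) ^ k) = (a + b) * (\<Sum>i<s. \<Sum>j<s. (\<gamma> i j - \<gamma>' i j) * a ^ i * b ^ j)"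
proof -
  define c where "c = a * b / (a + b)\<^sup>2"
  define H where "H = mat 2 2 (\<lambda>(i, j). if i = j then 1 else c)"
  define L where "L = mat 2 2 (\<lambda>(i, j). if i = j then (if i = 0 then a else b) else 0)"
  define u where "u e = vec 2 (\<lambda>i. if i = 0 then 1 else e)" for e :: real
  have ab: "a * b > 0" using a b by (simp add: mult_neg_neg)
  have "4 * (a * b) \<le> (a + b)\<^sup>2" using sum_squares_ge_zero[of "a - b" 0]
    by (simp add: power2_eq_square algebra_simps)
  moreover have abp: "(a + b)\<^sup>2 > 0" using a b by simp
  ultimately have c: "c > 0" "c \<le> 1/4" using ab by (auto simp: c_def field_simps)
  have c2: "c * (a + b)\<^sup>2 = a * b" using abp by (simp add: c_def)
  have Hc: "H \<in> carrier_mat 2 2" "transpose_mat H = H" and Lc: "L \<in> carrier_mat 2 2"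
    and uc: "\<And>e. u e \<in> carrier_vec 2"
    by (auto simp: H_def L_def u_def)
  have pd: "pos_def 2 H"
    unfolding pos_def_def
  proof (intro conjI ballI impI Hc)
    fix v :: "real vec" assume v: "v \<in> carrier_vec 2" "v \<noteq> 0\<^sub>v 2"
    then have nz: "v $ 0 \<noteq> 0 \<or> v $ Suc 0 \<noteq> 0"
      by (auto simp: vec_eq_iff less_2_cases_iff)
    have e: "v \<bullet> (H *\<^sub>v v) = (v $ 0 + c * v $ Suc 0)\<^sup>2 + (1 - c\<^sup>2) * (v $ Suc 0)\<^sup>2"
      using v by (simp add: H_def scalar_prod_def sum_lessThan_2 power2_eq_square algebra_simps)
    have "c\<^sup>2 < 1" using c by (simp add: power_less_one_iff)
    then show "v \<bullet> (H *\<^sub>v v) > 0" unfolding e using nz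
      by (cases "v $ Suc 0 = 0") (auto intro: add_nonneg_pos)
  qed
  have "neg_semidef 2 (transpose_mat L * H + H * L)"
    unfolding neg_semidef_def
  proof (intro conjI ballI)
    show "transpose_mat (transpose_mat L * H + H * L) = transpose_mat L * H + H * L"
      using Hc Lc by (subst transpose_add[of _ 2 2])
        (auto simp: transpose_mult[of _ 2 2 _ 2] intro!: comm_add_mat[of _ 2 2])
  next
    fix v :: "real vec" assume v: "v \<in> carrier_vec 2"
    have "v \<bullet> ((transpose_mat L * H + H * L) *\<^sub>v v) = - bracket_H H L v v"
      by (simp add: bracket_H_def)
    also have "\<dots> = 2 * (a * (v $ 0)\<^sup>2 + c * (a + b) * v $ 0 * v $ Suc 0 + b * (v $ Suc 0)\<^sup>2)"
      unfolding bracket_H_eq[OF Hc(1) Lc v v] using v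
      by (simp add: inner_H_def L_def H_def scalar_prod_def sum_lessThan_2 power2_eq_square algebra_simps)
    also have "\<dots> \<le> 0"
    proof -
      let ?x = "v $ 0" and ?y = "v $ Suc 0"
      have "4 * a * (a * ?x\<^sup>2 + c * (a + b) * ?x * ?y + b * ?y\<^sup>2) =
         (2 * a * ?x + c * (a + b) * ?y)\<^sup>2 + (4 * (a * b) - c * (c * (a + b)\<^sup>2)) * ?y\<^sup>2"
        by (simp add: power2_eq_square algebra_simps)
      also have "\<dots> = (2 * a * ?x + c * (a + b) * ?y)\<^sup>2 + (4 - c) * (a * b) * ?y\<^sup>2"
        unfolding c2 by (simp add: algebra_simps)
      also have "\<dots> \<ge> 0" using ab c by simp
      finally show ?thesis using a by (simp add: zero_le_mult_iff)
    qed
    finally show "v \<bullet> ((transpose_mat L * H + H * L) *\<^sub>v v) \<le> 0" .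
  qed (use Hc Lc in auto)
  then have sn: "semi_negative 2 H L" using Lc by (simp add: semi_negative_def)
  define x where "x e k = vec 2 (\<lambda>i. if i = 0 then a ^ k else e * b ^ k)" for e :: real and k :: nat
  have xc: "x e k \<in> carrier_vec 2" for e k by (simp add: x_def)
  have Lx: "L *\<^sub>v x e k = x e (Suc k)" for e k
    by (rule eq_vecI) (auto simp: x_def L_def scalar_prod_def sum_lessThan_2 less_2_cases_iff)
  have pow: "(L ^\<^sub>m k) *\<^sub>v u e = x e k" for e k
  proof (induction k)
    case 0
    then show ?case using uc Lc by (auto simp: u_def x_def)
  next
    case (Suc k)
    then show ?case using pow_mat_Suc_left[OF Lc uc] Lx by simp
  qed
  have inn: "inner_H H (x e i) (x e j) = a ^ i * a ^ j + c * e * (a ^ i * b ^ j + b ^ i * a ^ j) + e\<^sup>2 * b ^ i * b ^ j" for e i j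
    by (simp add: inner_H_def H_def x_def scalar_prod_def sum_lessThan_2 power2_eq_square algebra_simps)
  have br: "bracket_H H L (x e i) (x e j) = - (2 * a * a ^ i * a ^ j +
     c * e * (a + b) * (a ^ i * b ^ j + b ^ i * a ^ j) + 2 * b * e\<^sup>2 * b ^ i * b ^ j)" for e i j
    unfolding bracket_H_eq[OF Hc(1) Lc xc xc] Lx inn by (simp add: algebra_simps)
  define D where "D k = \<beta> k - \<beta>' k" for k
  define G where "G i j = \<gamma> i j - \<gamma>' i j" for i j
  have Gsym: "G i j = G j i" if "i < s" "j < s" for i j
    using E E' that unfolding energy_coeffs_def G_def by simp
  have id: "(\<Sum>k\<le>s. D k * inner_H H (x e k) (x e k)) +
     (\<Sum>i<s. \<Sum>j<s. G i j * bracket_H H L (x e i) (x e j)) = 0" for e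
  proof -
    have ee: "(norm_H H (rk_op s \<alpha> 1 L *\<^sub>v u e))\<^sup>2 = (\<Sum>k\<le>s. \<delta> k * inner_H H (x e k) (x e k)) +
     (\<Sum>i<s. \<Sum>j<s. \<eta> i j * bracket_H H L (x e i) (x e j))"
      if F: "energy_coeffs s \<alpha> \<delta> \<eta>" for \<delta> \<eta>
    proof -
      have "(norm_H H (rk_op s \<alpha> 1 L *\<^sub>v u e))\<^sup>2 =
          (\<Sum>k\<le>s. \<delta> k * 1 ^ (2 * k) * (norm_H H ((L ^\<^sub>m k) *\<^sub>v u e))\<^sup>2) +
          (\<Sum>i<s. \<Sum>j<s. \<eta> i j * 1 ^ (i + j + 1) *
             bracket_H H L ((L ^\<^sub>m i) *\<^sub>v u e) ((L ^\<^sub>m j) *\<^sub>v u e))"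
        by (rule F[unfolded energy_coeffs_def, THEN conjunct2, rule_format])
           (use pd sn uc in simp_all)
      then show ?thesis by (simp add: pow norm_H_square[OF pd xc])
    qed
    show ?thesis using ee[OF E] ee[OF E'] unfolding D_def G_def
      by (simp add: left_diff_distrib sum_subtractf)
  qed
  have fac: "4 * c * (X - d * Y) = 0" if "0 = 4 * c * X - 2 * c * d * (Y + Y)" for X Y d
    using that by (auto simp: algebra_simps)
  have d1: "D k * (inner_H H (x 1 k) (x 1 k) - inner_H H (x (-1) k) (x (-1) k)) =
     4 * c * (D k * (a * b) ^ k)" for k
    unfolding inn by (simp add: power_mult_distrib algebra_simps)
  have d2: "G i j * (bracket_H H L (x 1 i) (x 1 j) - bracket_H H L (x (-1) i) (x (-1) j)) =
     - (2 * c * (a + b) * (G i j * a ^ i * b ^ j + G i j * a ^ j * b ^ i))" for i j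
    unfolding br by (simp add: algebra_simps)
  have "0 = ((\<Sum>k\<le>s. D k * inner_H H (x 1 k) (x 1 k)) +
     (\<Sum>i<s. \<Sum>j<s. G i j * bracket_H H L (x 1 i) (x 1 j))) -
     ((\<Sum>k\<le>s. D k * inner_H H (x (-1) k) (x (-1) k)) +
     (\<Sum>i<s. \<Sum>j<s. G i j * bracket_H H L (x (-1) i) (x (-1) j)))"
    unfolding id by simp
  also have "\<dots> = (\<Sum>k\<le>s. D k * (inner_H H (x 1 k) (x 1 k) - inner_H H (x (-1) k) (x (-1) k))) +
     (\<Sum>i<s. \<Sum>j<s. G i j * (bracket_H H L (x 1 i) (x 1 j) - bracket_H H L (x (-1) i) (x (-1) j)))"
    by (simp add: right_diff_distrib sum_subtractf)
  also have "\<dots> = (\<Sum>k\<le>s. 4 * c * (D k * (a * b) ^ k)) -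
     (\<Sum>i<s. \<Sum>j<s. 2 * c * (a + b) * (G i j * a ^ i * b ^ j + G i j * a ^ j * b ^ i))"
    by (simp only: d1 d2 sum_negf add_uminus_conv_diff)
  also have "(\<Sum>i<s. \<Sum>j<s. 2 * c * (a + b) * (G i j * a ^ i * b ^ j + G i j * a ^ j * b ^ i)) =
     2 * c * (a + b) * ((\<Sum>i<s. \<Sum>j<s. G i j * a ^ i * b ^ j) + (\<Sum>i<s. \<Sum>j<s. G i j * a ^ j * b ^ i))"
    by (simp only: sum.distrib flip: sum_distrib_left)
  also have "(\<Sum>i<s. \<Sum>j<s. G i j * a ^ j * b ^ i) = (\<Sum>i<s. \<Sum>j<s. G i j * a ^ i * b ^ j)"
    by (subst sum.swap) (auto simp: Gsym intro!: sum.cong)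
  also have "(\<Sum>k\<le>s. 4 * c * (D k * (a * b) ^ k)) = 4 * c * (\<Sum>k\<le>s. D k * (a * b) ^ k)"
    by (simp only: sum_distrib_left)
  finally have "4 * c * ((\<Sum>k\<le>s. D k * (a * b) ^ k) - (a + b) * (\<Sum>i<s. \<Sum>j<s. G i j * a ^ i * b ^ j)) = 0"
    by (rule fac)
  then show ?thesis using c unfolding D_def G_def by simp
qed

lemma polyfun_zero_neg:
  fixes p :: "nat \<Rightarrow> real"
  assumes "\<And>x. x < 0 \<Longrightarrow> (\<Sum>i\<le>n. p i * x ^ i) = 0"
  shows "\<forall>i\<le>n. p i = 0"
proof (rule ccontr)
  assume "\<not> (\<forall>i\<le>n. p i = 0)"
  then have "finite {x. (\<Sum>i\<le>n. p i * x ^ i) = 0}" using polyfun_finite_roots[of p n] by blast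
  then have "finite {..<(0 :: real)}" by (rule finite_subset[rotated]) (use assms in auto)
  then show False using infinite_Iio by blast
qed

theorem energy_coeffs_unique:
  assumes E: "energy_coeffs s \<alpha> \<beta> \<gamma>" and E': "energy_coeffs s \<alpha> \<beta>' \<gamma>'"
  shows "\<forall>k\<le>s. \<beta> k = \<beta>' k" and "\<forall>i<s. \<forall>j<s. \<gamma> i j = \<gamma>' i j"
proof -
  define D where "D k = \<beta> k - \<beta>' k" for k
  define G where "G i j = (if i < s \<and> j < s then \<gamma> i j - \<gamma>' i j else 0)" for i j
  have t: "(\<Sum>k\<le>s. D k * (a * b) ^ k) = (a + b) * (\<Sum>i\<le>s. (\<Sum>j\<le>s. G i j * b ^ j) * a ^ i)"
    if "a < 0" "b < 0" for a b
  proof -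
    have "(\<Sum>i\<le>s. (\<Sum>j\<le>s. G i j * b ^ j) * a ^ i) = (\<Sum>i<s. \<Sum>j<s. G i j * a ^ i * b ^ j)"
      unfolding lessThan_Suc_atMost[symmetric]
      by (simp add: G_def sum_distrib_left ac_simps)
    also have "\<dots> = (\<Sum>i<s. \<Sum>j<s. (\<gamma> i j - \<gamma>' i j) * a ^ i * b ^ j)"
      by (intro sum.cong) (auto simp: G_def)
    finally show ?thesis using energy_coeffs_test[OF E E' that] by (simp add: D_def)
  qed
  have "(\<Sum>k\<le>s. D k * x ^ k) = 0" if x: "x < 0" for x
  proof -
    define b where "b = - sqrt (- x)"
    have b: "b < 0" "b * b = - x" using x by (auto simp: b_def)
    define p where "p i = D i * b ^ i" for i
    define q where "q i = (\<Sum>j\<le>s. G i j * b ^ j)" for i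
    define P where "P = (\<Sum>i\<le>s. monom (p i) i) - [:b, 1:] * (\<Sum>i\<le>s. monom (q i) i)"
    have ev: "poly P a = (\<Sum>k\<le>s. D k * (a * b) ^ k) - (a + b) * (\<Sum>i\<le>s. q i * a ^ i)" for a
      by (simp add: P_def p_def poly_sum poly_monom power_mult_distrib distrib_right ac_simps)
    have "P = 0"
    proof (rule ccontr)
      assume "P \<noteq> 0"
      then have "finite {a. poly P a = 0}" by (rule poly_roots_finite)
      then have "finite {..<(0 :: real)}"
        by (rule finite_subset[rotated]) (use ev t b in \<open>auto simp: q_def\<close>)
      then show False using infinite_Iio by blast
    qed
    then show ?thesis using ev[of "- b"] b by simp
  qed
  then have D: "\<forall>k\<le>s. D k = 0" by (rule polyfun_zero_neg)
  then show "\<forall>k\<le>s. \<beta> k = \<beta>' k" by (simp add: D_def)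
  have "\<forall>i\<le>s. (\<Sum>j\<le>s. G i j * b ^ j) = 0" if b: "b < 0" for b
    using polyfun_zero_neg[of "\<lambda>i. \<Sum>j\<le>s. G i j * b ^ j" s] t[OF _ b] D b by simp
  then have "\<forall>i\<le>s. \<forall>j\<le>s. G i j = 0"
    using polyfun_zero_neg[where n = s] by blast
  then show "\<forall>i<s. \<forall>j<s. \<gamma> i j = \<gamma>' i j"
    by (metis G_def eq_iff_diff_eq_0 less_imp_le)
qed

end

theory Submission
  imports Defs
begin

text \<open>Put \<open>S i j = \<tau>^(i+j+1) [L^i u, L^j u]\<^sub>H\<close> and \<open>p j = \<tau>^(2j) \<parallel>L^j u\<parallel>\<^sub>H\<^sup>2\<close>.  The kernel \<open>S\<close> is positive
  semidefinite, so negative definiteness of the leading block lets the diagonal entries \<open>S i i\<close> with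
  \<open>i < k\<close> absorb all mixed terms, and the \<open>\<gamma>\<close>-sum of the energy equality is at most
  \<open>C (\<Sum>i\<in>{k..<s}. S i i)\<close> with \<open>C\<close> depending only on \<open>\<gamma>\<close>.  If \<open>\<tau> \<parallel>L\<parallel>\<^sub>H \<le> lam \<le> 1\<close>, then
  \<open>S i i \<le> 2 lam p k\<close> for \<open>i \<ge> k\<close> and \<open>p j \<le> lam p k\<close> for \<open>j > k\<close>.  Hence
  \<open>\<parallel>R u\<parallel>\<^sub>H\<^sup>2 \<le> \<parallel>u\<parallel>\<^sub>H\<^sup>2 + (\<beta> k + O(lam)) p k\<close>, and \<open>\<beta> k < 0\<close> wins for small \<open>lam\<close>.\<close>

section \<open>Positive semidefinite kernels and coercivity of positive definite forms on
  them\<close>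

text \<open>Abstracts from Gram matrices of the iterates \<open>L^i u\<close> under a semi inner
  product. The sequence of iterates is infinite, so indexing by all of \<open>nat\<close> spares a
  size parameter.\<close>

definition psd_kernel :: "(nat \<Rightarrow> nat \<Rightarrow> real) \<Rightarrow> bool" where
  "psd_kernel S \<longleftrightarrow> (\<forall>i j. S i j = S j i) \<and>
     (\<forall>n c. 0 \<le> (\<Sum>i<n. \<Sum>j<n. c i * c j * S i j))"

lemma psd_kernel_sym: "psd_kernel S \<Longrightarrow> S i j = S j i"
  by (simp add: psd_kernel_def)

lemma psd_kernel_nonneg: "psd_kernel S \<Longrightarrow> 0 \<le> (\<Sum>i<n. \<Sum>j<n. c i * c j * S i j)"
  by (simp add: psd_kernel_def)

lemma psd_kernel_two:
  assumes "psd_kernel S"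
  shows "0 \<le> a\<^sup>2 * S i i + 2 * a * b * S i j + b\<^sup>2 * S j j"
proof -
  \<comment> \<open>The two weights are added so that \<open>i = j\<close> is covered as well; the
    claim then reads \<open>0 \<le> (a + b)\<^sup>2 * S i i\<close>.\<close>
  define c where "c l = (if l = i then a else 0) + (if l = j then b else 0)" for l
  define n where "n = Suc (max i j)"
  have e: "(\<Sum>l<n. c l * f l) = a * f i + b * f j" for f
  proof -
    have "(\<Sum>l<n. c l * f l) =
        (\<Sum>l<n. if l = i then a * f l else 0) + (\<Sum>l<n. if l = j then b * f l else 0)"
      unfolding sum.distrib[symmetric] by (intro sum.cong) (auto simp: c_def distrib_right)
    moreover have "i < n" "j < n" by (auto simp: n_def)
    ultimately show ?thesis by simp
  qed
  have "(\<Sum>l<n. \<Sum>m<n. c l * c m * S l m) = (\<Sum>l<n. c l * (\<Sum>m<n. c m * S l m))"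
    by (simp add: sum_distrib_left mult.assoc)
  also have "\<dots> = a * (a * S i i + b * S i j) + b * (a * S j i + b * S j j)"
    by (simp only: e)
  also have "\<dots> = a\<^sup>2 * S i i + 2 * a * b * S i j + b\<^sup>2 * S j j"
    using psd_kernel_sym[OF assms, of j i] by (simp add: power2_eq_square algebra_simps)
  finally show ?thesis using psd_kernel_nonneg[OF assms, of c n] by simp
qed

lemma psd_kernel_diag: "psd_kernel S \<Longrightarrow> 0 \<le> S i i"
  using psd_kernel_two[of S 1 i 0 i] by simp

text \<open>Cauchy-Schwarz in Young form, from the weights \<open>t\<close> and 1 or -1. The free
  parameter allows a mixed entry to be paid for by a small multiple of one diagonal entry and a
  large multiple of the other.\<close>

lemma psd_kernel_amgm:
  assumes S: "psd_kernel S" and t: "t > 0"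
  shows "2 * \<bar>S i j\<bar> \<le> t * S i i + S j j / t"
proof -
  have "2 * t * \<bar>S i j\<bar> \<le> t\<^sup>2 * S i i + S j j"
    using psd_kernel_two[OF S, of t i 1 j] psd_kernel_two[OF S, of t i "-1" j] t
    by (auto simp: abs_if)
  then show ?thesis using t by (simp add: field_simps power2_eq_square)
qed

lemma sum_sum_lessThan_Suc_sym:
  fixes f :: "nat \<Rightarrow> nat \<Rightarrow> real"
  assumes "\<And>i. i < n \<Longrightarrow> f n i = f i n"
  shows "(\<Sum>i<Suc n. \<Sum>j<Suc n. f i j) = (\<Sum>i<n. \<Sum>j<n. f i j) + 2 * (\<Sum>i<n. f i n) + f n n"
  using assms by (simp add: sum.distrib)

text \<open>The constant must not depend on \<open>S\<close>.  Taking \<open>S i j = v i * v j\<close> gives the usual lower bound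
  by the smallest eigenvalue; Gram matrices of arbitrary semi inner products are needed as well.\<close>

lemma psd_kernel_coercive:
  fixes A :: "nat \<Rightarrow> nat \<Rightarrow> real"
  assumes "\<And>i j. i < n \<Longrightarrow> j < n \<Longrightarrow> A i j = A j i"
    and "\<And>v. \<exists>i<n. v i \<noteq> 0 \<Longrightarrow> 0 < (\<Sum>i<n. \<Sum>j<n. A i j * (v i * v j))"
  shows "\<exists>\<epsilon>>0. \<forall>S. psd_kernel S \<longrightarrow> \<epsilon> * (\<Sum>i<n. S i i) \<le> (\<Sum>i<n. \<Sum>j<n. A i j * S i j)"
  using assms
proof (induction n arbitrary: A)
  case 0
  show ?case by (intro exI[of _ 1]) simp
next
  case (Suc n)
  define d where "d = A n n"
  define a where "a i = A i n" for i
  \<comment> \<open>completing the square in the last variable leaves the Schur complement \<open>A'\<close>\<close>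
  define A' where "A' i j = A i j - a i * a j / d" for i j
  have An: "A n i = a i" if "i < n" for i using Suc.prems(1)[of i n] that by (simp add: a_def)
  have d: "d > 0"
  proof -
    define v where "v i = (if i = n then 1 else 0 :: real)" for i
    have "(\<Sum>i<n. \<Sum>j<n. A i j * (v i * v j)) = 0" "(\<Sum>i<n. A i n * (v i * v n)) = 0"
      by (simp_all add: v_def)
    moreover have "0 < (\<Sum>i<Suc n. \<Sum>j<Suc n. A i j * (v i * v j))"
      by (rule Suc.prems(2)) (auto simp: v_def)
    ultimately show ?thesis
      by (subst (asm) sum_sum_lessThan_Suc_sym)
         (auto simp: d_def v_def Suc.prems(1) mult.commute)
  qed
  have split: "(\<Sum>i<n. \<Sum>j<n. A i j * S i j) =
      (\<Sum>i<n. \<Sum>j<n. A' i j * S i j) + (\<Sum>i<n. \<Sum>j<n. a i * a j * S i j) / d" for S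
    unfolding A'_def sum_divide_distrib sum.distrib[symmetric]
    by (intro sum.cong refl) (simp add: algebra_simps)
  have "\<exists>\<epsilon>>0. \<forall>S. psd_kernel S \<longrightarrow> \<epsilon> * (\<Sum>i<n. S i i) \<le> (\<Sum>i<n. \<Sum>j<n. A' i j * S i j)"
  proof (rule Suc.IH)
    show "A' i j = A' j i" if "i < n" "j < n" for i j
      using Suc.prems(1)[of i j] that by (simp add: A'_def)
    show "0 < (\<Sum>i<n. \<Sum>j<n. A' i j * (v i * v j))" if v: "\<exists>i<n. v i \<noteq> 0" for v
    proof -
      define p where "p = (\<Sum>i<n. a i * v i)"
      \<comment> \<open>The last coordinate \<open>- p / d\<close> minimises the form of
        \<open>A\<close> over the last variable, and the minimum is the form of the Schur complement
        at \<open>v\<close>.\<close>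
      define w where "w = v(n := - p / d)"
      have "0 < (\<Sum>i<Suc n. \<Sum>j<Suc n. A i j * (w i * w j))"
        by (rule Suc.prems(2)) (use v in \<open>auto simp: w_def\<close>)
      also have "\<dots> = (\<Sum>i<n. \<Sum>j<n. A i j * (v i * v j)) + 2 * (- p / d * p) + d * (p / d)\<^sup>2"
      proof (subst sum_sum_lessThan_Suc_sym)
        show "A n i * (w n * w i) = A i n * (w i * w n)" if "i < n" for i
          using An that by (simp add: a_def)
        have "(\<Sum>i<n. A i n * (w i * w n)) = - p / d * p"
          unfolding p_def sum_distrib_left by (intro sum.cong) (auto simp: w_def a_def p_def)
        moreover have "(\<Sum>i<n. \<Sum>j<n. A i j * (w i * w j)) = (\<Sum>i<n. \<Sum>j<n. A i j * (v i * v j))"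
          by (intro sum.cong) (auto simp: w_def)
        ultimately show "(\<Sum>i<n. \<Sum>j<n. A i j * (w i * w j)) + 2 * (\<Sum>i<n. A i n * (w i * w n)) +
            A n n * (w n * w n) =
            (\<Sum>i<n. \<Sum>j<n. A i j * (v i * v j)) + 2 * (- p / d * p) + d * (p / d)\<^sup>2"
          by (simp add: w_def d_def power2_eq_square)
      qed
      also have "\<dots> = (\<Sum>i<n. \<Sum>j<n. A' i j * (v i * v j))"
      proof -
        have "(\<Sum>i<n. \<Sum>j<n. a i * a j * (v i * v j)) = p * p"
          unfolding p_def sum_product by (intro sum.cong refl) simp
        then show ?thesis using d unfolding split by (simp add: field_simps power2_eq_square)
      qed
      finally show ?thesis .
    qed
  qed
  then obtain e where e: "e > 0"
    and eS: "\<And>S. psd_kernel S \<Longrightarrow> e * (\<Sum>i<n. S i i) \<le> (\<Sum>i<n. \<Sum>j<n. A' i j * S i j)"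
    by blast
  \<comment> \<open>half of the surplus \<open>e\<close> on the first \<open>n\<close> variables pays for the mixed terms of the square\<close>
  define m where "m = 1 + (\<Sum>i<n. \<bar>a i\<bar>)"
  have am: "\<bar>a i\<bar> \<le> m" if "i < n" for i
    using member_le_sum[of i "{..<n}" "\<lambda>i. \<bar>a i\<bar>"] that by (simp add: m_def)
  have m: "m > 0" unfolding m_def by (intro add_pos_nonneg sum_nonneg) auto
  \<comment> \<open>Since the completed square \<open>T\<close> below is nonnegative,
    \<open>T / d\<close> may be lowered to \<open>\<eta> * T\<close> for any
    \<open>\<eta> \<le> 1 / d\<close>. The other bound in the minimum keeps the resulting loss
    \<open>\<eta> * (2 * m\<^sup>2)\<close> within \<open>e / 2\<close>.\<close>
  define \<eta> where "\<eta> = min (1 / d) (e / (4 * m\<^sup>2))"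
  have eta: "\<eta> > 0" "\<eta> \<le> 1 / d" "\<eta> * (2 * m\<^sup>2) \<le> e / 2"
    using d e m by (auto simp: \<eta>_def field_simps min_def)
  define \<epsilon> where "\<epsilon> = min (e / 2) (\<eta> * d\<^sup>2 / 2)"
  have eps: "\<epsilon> > 0" "\<epsilon> \<le> e / 2" "\<epsilon> \<le> \<eta> * d\<^sup>2 / 2" using e eta d by (auto simp: \<epsilon>_def)
  have "\<epsilon> * (\<Sum>i<Suc n. S i i) \<le> (\<Sum>i<Suc n. \<Sum>j<Suc n. A i j * S i j)" if S: "psd_kernel S" for S
  proof -
    define \<sigma> where "\<sigma> = (\<Sum>i<n. S i i)"
    define X where "X = (\<Sum>i<n. \<Sum>j<n. a i * a j * S i j)"
    define Y where "Y = (\<Sum>i<n. a i * S i n)"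
    \<comment> \<open>The form of \<open>S\<close> with the weights \<open>a\<close> on the first
      \<open>Suc n\<close> indices, where \<open>a n = d\<close>; dividing by \<open>d\<close> gives
      the square split off from \<open>A\<close>.\<close>
    define T where "T = X + 2 * d * Y + d\<^sup>2 * S n n"
    have an: "a n = d" by (simp add: a_def d_def)
    have sig: "\<sigma> \<ge> 0" unfolding \<sigma>_def using psd_kernel_diag[OF S] by (simp add: sum_nonneg)
    have X: "X \<ge> 0" unfolding X_def by (rule psd_kernel_nonneg[OF S])
    have total: "(\<Sum>i<Suc n. \<Sum>j<Suc n. A i j * S i j) = (\<Sum>i<n. \<Sum>j<n. A' i j * S i j) + T / d"
    proof (subst sum_sum_lessThan_Suc_sym)
      show "A n i * S n i = A i n * S i n" if "i < n" for i
        using An[OF that] psd_kernel_sym[OF S, of n i] by (simp add: a_def)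
      show "(\<Sum>i<n. \<Sum>j<n. A i j * S i j) + 2 * (\<Sum>i<n. A i n * S i n) + A n n * S n n =
          (\<Sum>i<n. \<Sum>j<n. A' i j * S i j) + T / d"
        unfolding split a_def[symmetric] an T_def X_def[symmetric] Y_def[symmetric]
        using d by (simp add: field_simps power2_eq_square)
    qed
    have T0: "T \<ge> 0"
    proof -
      have "(\<Sum>i<n. a i * a n * S i n) = d * Y"
        unfolding Y_def sum_distrib_left an by (intro sum.cong) auto
      moreover have "a n * a i * S n i = a i * a n * S i n" for i
        using psd_kernel_sym[OF S, of n i] by simp
      ultimately have "T = (\<Sum>i<Suc n. \<Sum>j<Suc n. a i * a j * S i j)"
        by (subst sum_sum_lessThan_Suc_sym) (simp_all add: T_def X_def an power2_eq_square)
      then show ?thesis using psd_kernel_nonneg[OF S, of a "Suc n"] by (simp only:)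
    qed
    \<comment> \<open>Young with parameter \<open>2 * m / d\<close>, chosen so that
      \<open>2 * d * Y\<close> costs only half of the term \<open>d\<^sup>2 * S n n\<close> in
      \<open>T\<close>.\<close>
    have Y: "2 * \<bar>Y\<bar> \<le> 2 * m\<^sup>2 / d * \<sigma> + d / 2 * S n n"
    proof -
      have "2 * \<bar>Y\<bar> \<le> 2 * (\<Sum>i<n. \<bar>a i * S i n\<bar>)"
        unfolding Y_def using sum_abs[of "\<lambda>i. a i * S i n" "{..<n}"] by simp
      also have "\<dots> = (\<Sum>i<n. \<bar>a i\<bar> * (2 * \<bar>S i n\<bar>))"
        unfolding sum_distrib_left by (intro sum.cong refl) (simp add: abs_mult)
      also have "\<dots> \<le> (\<Sum>i<n. \<bar>a i\<bar> * (2 * m / d * S i i + S n n / (2 * m / d)))"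
        using d m by (intro sum_mono mult_left_mono psd_kernel_amgm[OF S]) auto
      also have "\<dots> = 2 * m / d * (\<Sum>i<n. \<bar>a i\<bar> * S i i) + (\<Sum>i<n. \<bar>a i\<bar>) * (S n n / (2 * m / d))"
        unfolding sum_distrib_left sum_distrib_right sum.distrib[symmetric]
        by (intro sum.cong refl) (simp add: algebra_simps)
      also have "\<dots> \<le> 2 * m / d * (m * \<sigma>) + m * (S n n / (2 * m / d))"
        unfolding \<sigma>_def sum_distrib_left[of m]
        using d m am psd_kernel_diag[OF S]
        by (intro add_mono mult_left_mono mult_right_mono sum_mono) (auto simp: m_def)
      also have "\<dots> = 2 * m\<^sup>2 / d * \<sigma> + d / 2 * S n n" using d m by (simp add: field_simps power2_eq_square)
      finally show ?thesis .
    qed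
    have "d * (2 * \<bar>Y\<bar>) \<le> 2 * m\<^sup>2 * \<sigma> + d\<^sup>2 / 2 * S n n"
    proof -
      have "d * (2 * m\<^sup>2 / d * \<sigma> + d / 2 * S n n) = 2 * m\<^sup>2 * \<sigma> + d\<^sup>2 / 2 * S n n"
        using d by (simp add: field_simps power2_eq_square)
      then show ?thesis using mult_left_mono[OF Y, of d] d by simp
    qed
    moreover have "- (d * (2 * \<bar>Y\<bar>)) \<le> 2 * d * Y"
      using mult_left_mono[of "- \<bar>Y\<bar>" Y "2 * d"] d by simp
    ultimately have "d\<^sup>2 / 2 * S n n - 2 * m\<^sup>2 * \<sigma> \<le> T" unfolding T_def using X by linarith
    then have "\<eta> * (d\<^sup>2 / 2 * S n n - 2 * m\<^sup>2 * \<sigma>) \<le> \<eta> * T" using eta by simp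
    also have "\<dots> \<le> T / d" using mult_right_mono[OF eta(2) T0] by simp
    finally have "\<eta> * d\<^sup>2 / 2 * S n n - \<eta> * (2 * m\<^sup>2) * \<sigma> \<le> T / d" by (simp add: algebra_simps)
    moreover have "\<eta> * (2 * m\<^sup>2) * \<sigma> \<le> e / 2 * \<sigma>" using eta(3) sig by (rule mult_right_mono)
    moreover have "\<epsilon> * \<sigma> \<le> e / 2 * \<sigma>" using eps(2) sig by (rule mult_right_mono)
    moreover have "\<epsilon> * S n n \<le> \<eta> * d\<^sup>2 / 2 * S n n"
      using eps(3) psd_kernel_diag[OF S] by (rule mult_right_mono)
    moreover have "e * \<sigma> \<le> (\<Sum>i<n. \<Sum>j<n. A' i j * S i j)" using eS[OF S] by (simp add: \<sigma>_def)
    ultimately show ?thesis unfolding total by (simp add: \<sigma>_def[symmetric] distrib_left)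
  qed
  then show ?case using eps(1) by blast
qed

section \<open>Gram kernels of the weighted inner product and of the bracket\<close>

lemma psd_kernel_mult: "psd_kernel (\<lambda>i j. f i * f j)"
proof -
  have "(\<Sum>i<n. \<Sum>j<n. c i * c j * (f i * f j)) = (\<Sum>i<n. c i * f i)\<^sup>2" for n c
    unfolding power2_eq_square sum_product by (intro sum.cong refl) simp
  then show ?thesis by (simp add: psd_kernel_def)
qed

text \<open>By bilinearity, weights \<open>c\<close> produce the \<open>M\<close>-form of the single
  vector \<open>\<Sum>i<n. c i * x i\<close>. Semidefinite \<open>M\<close> is allowed because the
  bracket is only a semi inner product.\<close>

lemma psd_kernel_Gram:
  assumes M: "M \<in> carrier_mat N N" "transpose_mat M = M"
    and pos: "\<And>v. v \<in> carrier_vec N \<Longrightarrow> 0 \<le> inner_H M v v"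
    and x: "\<And>i. x i \<in> carrier_vec N"
  shows "psd_kernel (\<lambda>i j. inner_H M (x i) (x j))"
  unfolding psd_kernel_def
proof (intro conjI allI)
  show "inner_H M (x i) (x j) = inner_H M (x j) (x i)" for i j
    by (rule inner_H_commute[OF M x x])
  fix n and c :: "nat \<Rightarrow> real"
  define v where "v = vec N (\<lambda>l. \<Sum>i<n. c i * x i $ l)"
  have v: "v \<in> carrier_vec N" by (simp add: v_def)
  have "inner_H M v v =
      (\<Sum>p<N. \<Sum>q<N. M $$ (p, q) * ((\<Sum>i<n. c i * x i $ p) * (\<Sum>j<n. c j * x j $ q)))"
    unfolding inner_H_sums[OF M(1) v v] by (simp add: v_def)
  also have "\<dots> = (\<Sum>p<N. \<Sum>q<N. \<Sum>i<n. \<Sum>j<n. c i * c j * (M $$ (p, q) * (x i $ p * x j $ q)))"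
    by (intro sum.cong refl, subst sum_product) (simp add: sum_distrib_left ac_simps)
  also have "\<dots> = (\<Sum>i<n. \<Sum>j<n. \<Sum>p<N. \<Sum>q<N. c i * c j * (M $$ (p, q) * (x i $ p * x j $ q)))"
    by (subst sum.swap, subst (2) sum.swap,
        subst (3) sum.swap, subst (2) sum.swap) (rule refl)
  also have "\<dots> = (\<Sum>i<n. \<Sum>j<n. c i * c j * inner_H M (x i) (x j))"
    unfolding inner_H_sums[OF M(1) x x] by (simp add: sum_distrib_left)
  finally show "0 \<le> (\<Sum>i<n. \<Sum>j<n. c i * c j * inner_H M (x i) (x j))" using pos[OF v] by simp
qed

text \<open>Inserts the powers of \<open>\<tau>\<close>: \<open>f i = \<tau> ^ i\<close> yields
  \<open>\<tau> ^ (i + j)\<close>, and \<open>a\<close> supplies the extra factor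
  \<open>\<tau>\<close> of the bracket terms.\<close>

lemma psd_kernel_scale:
  assumes S: "psd_kernel S" and a: "a \<ge> 0"
  shows "psd_kernel (\<lambda>i j. a * (f i * f j * S i j))"
  unfolding psd_kernel_def
proof (intro conjI allI)
  show "a * (f i * f j * S i j) = a * (f j * f i * S j i)" for i j
    using psd_kernel_sym[OF S, of i j] by simp
  fix n and c :: "nat \<Rightarrow> real"
  have "(\<Sum>i<n. \<Sum>j<n. c i * c j * (a * (f i * f j * S i j))) =
      a * (\<Sum>i<n. \<Sum>j<n. (c i * f i) * (c j * f j) * S i j)"
    by (simp add: sum_distrib_left ac_simps)
  then show "0 \<le> (\<Sum>i<n. \<Sum>j<n. c i * c j * (a * (f i * f j * S i j)))"
    using psd_kernel_nonneg[OF S, of "\<lambda>i. c i * f i" n] a by simp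
qed

lemma inner_H_nonneg: "pos_def N H \<Longrightarrow> v \<in> carrier_vec N \<Longrightarrow> 0 \<le> inner_H H v v"
  using norm_H_square[of N H v] zero_le_power2[of "norm_H H v"] by simp

lemma psd_kernel_inner_H:
  assumes "pos_def N H" "\<And>i. x i \<in> carrier_vec N"
  shows "psd_kernel (\<lambda>i j. inner_H H (x i) (x j))"
proof (rule psd_kernel_Gram[OF _ _ inner_H_nonneg[OF assms(1)] assms(2)])
  show "H \<in> carrier_mat N N" "transpose_mat H = H" using assms(1) by (simp_all add: pos_def_def)
qed

lemma psd_kernel_bracket_H:
  assumes H: "H \<in> carrier_mat N N" and L: "semi_negative N H L" and x: "\<And>i. x i \<in> carrier_vec N"
  shows "psd_kernel (\<lambda>i j. bracket_H H L (x i) (x j))"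
proof -
  define M where "M = - (transpose_mat L * H + H * L)"
  have c: "transpose_mat L * H + H * L \<in> carrier_mat N N"
    and sym: "transpose_mat (transpose_mat L * H + H * L) = transpose_mat L * H + H * L"
    using L by (auto simp: semi_negative_def neg_semidef_def)
  have M: "M \<in> carrier_mat N N" using c by (simp add: M_def)
  have e: "bracket_H H L v w = inner_H M v w" if "v \<in> carrier_vec N" "w \<in> carrier_vec N" for v w
  proof -
    have "bracket_H H L v w = - inner_H (transpose_mat L * H + H * L) v w"
      by (simp add: bracket_H_def inner_H_def)
    also have "\<dots> = inner_H M v w"
      unfolding inner_H_sums[OF c that] inner_H_sums[OF M that] sum_negf[symmetric]
      using H L by (intro sum.cong refl) (auto simp: M_def semi_negative_def algebra_simps)
    finally show ?thesis .
  qed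
  have "psd_kernel (\<lambda>i j. inner_H M (x i) (x j))"
  proof (rule psd_kernel_Gram[OF M _ _ x])
    show "transpose_mat M = M" unfolding M_def using sym
      by (metis transpose_uminus)
    show "0 \<le> inner_H M v v" if "v \<in> carrier_vec N" for v
      using L that unfolding e[OF that that, symmetric]
      by (auto simp: semi_negative_def neg_semidef_def bracket_H_def)
  qed
  then show ?thesis by (simp add: e x)
qed

section \<open>The operator norm induced by \<open>H\<close>\<close>

text \<open>The case of rank-one kernels \<open>v $ i * v $ j\<close> in
  \<open>psd_kernel_coercive\<close>. It bounds the Euclidean norm by the
  \<open>H\<close>-norm.\<close>

lemma pos_def_inner_H_coercive:
  assumes H: "pos_def N H"
  shows "\<exists>\<epsilon>>0. \<forall>v \<in> carrier_vec N. \<epsilon> * (\<Sum>i<N. (v $ i)\<^sup>2) \<le> inner_H H v v"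
proof -
  have Hc: "H \<in> carrier_mat N N" "transpose_mat H = H" using H by (auto simp: pos_def_def)
  have "\<exists>\<epsilon>>0. \<forall>S. psd_kernel S \<longrightarrow>
      \<epsilon> * (\<Sum>i<N. S i i) \<le> (\<Sum>i<N. \<Sum>j<N. H $$ (i, j) * S i j)"
  proof (rule psd_kernel_coercive)
    show "H $$ (i, j) = H $$ (j, i)" if "i < N" "j < N" for i j
      using that Hc by (metis carrier_matD index_transpose_mat(1))
    fix v :: "nat \<Rightarrow> real" assume "\<exists>i<N. v i \<noteq> 0"
    then have "vec N v \<noteq> 0\<^sub>v N" by (auto simp: vec_eq_iff)
    then have "0 < inner_H H (vec N v) (vec N v)"
      using H by (auto simp: pos_def_def inner_H_def)
    then show "0 < (\<Sum>i<N. \<Sum>j<N. H $$ (i, j) * (v i * v j))"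
      by (subst (asm) inner_H_sums[OF Hc(1)]) simp_all
  qed
  then show ?thesis
    using psd_kernel_mult by (fastforce simp: inner_H_sums[OF Hc(1)] power2_eq_square)
qed

lemma inner_H_upper_bound:
  assumes M: "M \<in> carrier_mat N N" and v: "v \<in> carrier_vec N"
  shows "inner_H M v v \<le> (\<Sum>i<N. \<Sum>j<N. \<bar>M $$ (i, j)\<bar>) * (\<Sum>i<N. (v $ i)\<^sup>2)"
proof -
  have m: "(v $ i)\<^sup>2 \<le> (\<Sum>i<N. (v $ i)\<^sup>2)" if "i < N" for i
    by (rule member_le_sum) (use that in auto)
  have vv: "\<bar>v $ i * v $ j\<bar> \<le> (\<Sum>i<N. (v $ i)\<^sup>2)" if "i < N" "j < N" for i j
    using m[OF that(1)] m[OF that(2)] sum_squares_bound[of "\<bar>v $ i\<bar>" "\<bar>v $ j\<bar>"]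
    by (simp add: abs_mult)
  have "M $$ (i, j) * (v $ i * v $ j) \<le> \<bar>M $$ (i, j)\<bar> * (\<Sum>i<N. (v $ i)\<^sup>2)"
    if "i < N" "j < N" for i j
  proof -
    have "M $$ (i, j) * (v $ i * v $ j) \<le> \<bar>M $$ (i, j)\<bar> * \<bar>v $ i * v $ j\<bar>"
      unfolding abs_mult[symmetric] by (rule abs_ge_self)
    also have "\<dots> \<le> \<bar>M $$ (i, j)\<bar> * (\<Sum>i<N. (v $ i)\<^sup>2)"
      by (rule mult_left_mono[OF vv[OF that]]) simp
    finally show ?thesis .
  qed
  then show ?thesis
    unfolding inner_H_sums[OF M v v] sum_distrib_right by (intro sum_mono) auto
qed

text \<open>The supremum can be used only once the quotients are bounded. Coercivity of
  \<open>H\<close> and the entrywise bound on the form of \<open>A^T H A\<close> give the bound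
  \<open>sqrt (K / \<epsilon>)\<close>.\<close>

lemma norm_H_mult_le_opnorm_H:
  assumes H: "pos_def N H" and A: "A \<in> carrier_mat N N" and v: "v \<in> carrier_vec N"
  shows "norm_H H (A *\<^sub>v v) \<le> opnorm_H H A * norm_H H v"
proof -
  have Hc: "H \<in> carrier_mat N N" using H by (simp add: pos_def_def)
  obtain \<epsilon> where e: "\<epsilon> > 0" "\<And>v. v \<in> carrier_vec N \<Longrightarrow> \<epsilon> * (\<Sum>i<N. (v $ i)\<^sup>2) \<le> inner_H H v v"
    using pos_def_inner_H_coercive[OF H] by blast
  define M where "M = transpose_mat A * (H * A)"
  define K where "K = (\<Sum>i<N. \<Sum>j<N. \<bar>M $$ (i, j)\<bar>)"
  have K: "K \<ge> 0" by (simp add: K_def sum_nonneg)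
  have M: "M \<in> carrier_mat N N" using A Hc by (auto simp: M_def)
  have inM: "inner_H H (A *\<^sub>v w) (A *\<^sub>v w) = inner_H M w w" if w: "w \<in> carrier_vec N" for w
  proof -
    have c: "H *\<^sub>v (A *\<^sub>v w) \<in> carrier_vec N" "A *\<^sub>v w \<in> carrier_vec N" using Hc A w by auto
    have "inner_H M w w = w \<bullet> (transpose_mat A *\<^sub>v (H *\<^sub>v (A *\<^sub>v w)))"
      unfolding inner_H_def M_def using Hc A w
      by (simp add: assoc_mult_mat_vec[of _ N N _ N])
    also have "\<dots> = (transpose_mat A *\<^sub>v (H *\<^sub>v (A *\<^sub>v w))) \<bullet> w"
      by (rule comm_scalar_prod[of _ N]) (use A c w in auto)
    also have "\<dots> = (H *\<^sub>v (A *\<^sub>v w)) \<bullet> (A *\<^sub>v w)"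
      by (rule transpose_vec_mult_scalar[OF A w c(1)])
    also have "\<dots> = inner_H H (A *\<^sub>v w) (A *\<^sub>v w)"
      unfolding inner_H_def by (rule comm_scalar_prod[OF c])
    finally show ?thesis by simp
  qed
  have bound: "norm_H H (A *\<^sub>v w) \<le> sqrt (K / \<epsilon>) * norm_H H w" if w: "w \<in> carrier_vec N" for w
  proof -
    have "inner_H H (A *\<^sub>v w) (A *\<^sub>v w) \<le> K * (\<Sum>i<N. (w $ i)\<^sup>2)"
      unfolding inM[OF w] K_def by (rule inner_H_upper_bound[OF M w])
    also have "\<dots> \<le> K * (inner_H H w w / \<epsilon>)"
      using e(1) e(2)[OF w] K by (intro mult_left_mono) (simp_all add: field_simps)
    finally show ?thesis unfolding norm_H_def by (simp flip: real_sqrt_mult)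
  qed
  have nn: "norm_H H w \<ge> 0" if "w \<in> carrier_vec N" for w
    using inner_H_nonneg[OF H that] by (simp add: norm_H_def)
  have "bdd_above ((\<lambda>w. norm_H H (A *\<^sub>v w) / norm_H H w) ` carrier_vec (dim_row H))"
  proof (rule bdd_aboveI2)
    fix w :: "real vec" assume "w \<in> carrier_vec (dim_row H)"
    then have w: "w \<in> carrier_vec N" using Hc by simp
    show "norm_H H (A *\<^sub>v w) / norm_H H w \<le> sqrt (K / \<epsilon>)"
      using bound[OF w] nn[OF w] K e(1) by (cases "norm_H H w = 0") (auto simp: field_simps)
  qed
  then have "norm_H H (A *\<^sub>v v) / norm_H H v \<le> opnorm_H H A"
    unfolding opnorm_H_def
    using cSUP_upper[of v "carrier_vec (dim_row H)" "\<lambda>w. norm_H H (A *\<^sub>v w) / norm_H H w"] v Hc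
    by auto
  \<comment> \<open>If \<open>norm_H H v = 0\<close>, the quotient is 0 by convention and says
    nothing; \<open>bound\<close> itself then forces the left side to be at most 0.\<close>
  then show ?thesis using bound[OF v] nn[OF v]
    by (cases "norm_H H v = 0") (auto simp: field_simps)
qed

lemma opnorm_H_le_one:
  assumes H: "pos_def N H" and le: "\<And>v. v \<in> carrier_vec N \<Longrightarrow> norm_H H (A *\<^sub>v v) \<le> norm_H H v"
  shows "opnorm_H H A \<le> 1"
  unfolding opnorm_H_def
proof (rule cSUP_least)
  have "0\<^sub>v (dim_row H) \<in> carrier_vec (dim_row H)" by simp
  then show "carrier_vec (dim_row H) \<noteq> ({} :: real vec set)" by blast
  fix v :: "real vec" assume "v \<in> carrier_vec (dim_row H)"
  then have v: "v \<in> carrier_vec N" using H by (auto simp: pos_def_def)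
  have "norm_H H v \<ge> 0" using inner_H_nonneg[OF H v] by (simp add: norm_H_def)
  then show "norm_H H (A *\<^sub>v v) / norm_H H v \<le> 1"
    using le[OF v] by (cases "norm_H H v = 0") auto
qed

section \<open>Absorption of mixed terms by the negative definite leading block\<close>

text \<open>Coercivity of the negated block leaves a surplus \<open>\<epsilon> * S i i\<close> for
  every \<open>i < k\<close>. Young's inequality charges a pair with one index below
  \<open>k\<close> partly to this surplus and partly to the diagonal entry at the other index; pairs
  with both indices at least \<open>k\<close> are charged only to entries from \<open>k\<close>
  on.\<close>

lemma psd_kernel_neg_def_block:
  fixes g :: "nat \<Rightarrow> nat \<Rightarrow> real"
  assumes k: "k \<le> s" and neg: "neg_def k (leading_submatrix k g)"
  shows "\<exists>C\<ge>0. \<forall>S. psd_kernel S \<longrightarrow>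
    (\<Sum>i<s. \<Sum>j<s. g i j * S i j) \<le> C * (\<Sum>i\<in>{k..<s}. S i i)"
proof (cases "s = 0")
  case True
  then show ?thesis by auto
next
  case False
  then have s: "real s > 0" by simp
  have sym: "g i j = g j i" if "i < k" "j < k" for i j
  proof -
    have "transpose_mat (leading_submatrix k g) $$ (i, j) = leading_submatrix k g $$ (i, j)"
      using neg by (simp add: neg_def_def)
    then show ?thesis using that by (simp add: leading_submatrix_def)
  qed
  have "\<exists>\<epsilon>>0. \<forall>S. psd_kernel S \<longrightarrow> \<epsilon> * (\<Sum>i<k. S i i) \<le> (\<Sum>i<k. \<Sum>j<k. - g i j * S i j)"
  proof (rule psd_kernel_coercive)
    show "- g i j = - g j i" if "i < k" "j < k" for i j using sym that by simp
    fix v :: "nat \<Rightarrow> real" assume "\<exists>i<k. v i \<noteq> 0"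
    then have "vec k v \<noteq> 0\<^sub>v k" by (auto simp: vec_eq_iff)
    then have "inner_H (leading_submatrix k g) (vec k v) (vec k v) < 0"
      using neg by (auto simp: neg_def_def inner_H_def)
    then show "0 < (\<Sum>i<k. \<Sum>j<k. - g i j * (v i * v j))"
      by (subst (asm) inner_H_sums[of _ k]) (simp_all add: leading_submatrix_def sum_negf)
  qed
  then obtain \<epsilon> where e: "\<epsilon> > 0"
    and eS: "\<And>S. psd_kernel S \<Longrightarrow> \<epsilon> * (\<Sum>i<k. S i i) \<le> (\<Sum>i<k. \<Sum>j<k. - g i j * S i j)"
    by blast
  define M where "M = 1 + (\<Sum>i<s. \<Sum>j<s. \<bar>g i j\<bar>)"
  have M: "M > 0" unfolding M_def by (intro add_pos_nonneg sum_nonneg) auto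
  have gM: "\<bar>g i j\<bar> \<le> M" if "i < s" "j < s" for i j
  proof -
    have "\<bar>g i j\<bar> \<le> (\<Sum>j<s. \<bar>g i j\<bar>)" by (rule member_le_sum) (use that in auto)
    also have "\<dots> \<le> (\<Sum>i<s. \<Sum>j<s. \<bar>g i j\<bar>)"
      by (rule member_le_sum) (use that in \<open>auto intro: sum_nonneg\<close>)
    finally show ?thesis by (simp add: M_def)
  qed
  \<comment> \<open>\<open>t\<close> is chosen so that the mixed terms use up exactly \<open>\<epsilon> (\<Sum>i<k. S i i)\<close>, see \<open>tM\<close>\<close>
  define t where "t = \<epsilon> / (s * M)"
  define D where "D = M / 2 + M / (2 * t)"
  have t: "t > 0" using e s M by (simp add: t_def)
  have tM: "M / 2 * t = \<epsilon> / (2 * s)" using M s by (simp add: t_def)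
  have D: "M / 2 \<le> D" "M / (2 * t) \<le> D" "D \<ge> 0" using M t by (auto simp: D_def)
  have "(\<Sum>i<s. \<Sum>j<s. g i j * S i j) \<le> 2 * s * D * (\<Sum>i\<in>{k..<s}. S i i)"
    if S: "psd_kernel S" for S
  proof -
    note pos = psd_kernel_diag[OF S]
    \<comment> \<open>The charge to index \<open>i\<close>. Each pair is charged
      \<open>h i + h j\<close>, including pairs in the leading block, where this is harmless as
      \<open>h\<close> is nonnegative. So each index is charged \<open>2 * s\<close> times, and
      \<open>\<epsilon> / (2 * s)\<close> adds up to \<open>\<epsilon>\<close>.\<close>
    define h where "h i = (if i < k then \<epsilon> / (2 * s) else D) * S i i" for i
    have h: "h i \<ge> 0" for i using pos[of i] e D by (auto simp: h_def)
    have gS: "g i j * S i j \<le> M / 2 * (r * S i i + S j j / r)" if "i < s" "j < s" "r > 0" for i j r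
    proof -
      have "g i j * S i j \<le> \<bar>g i j\<bar> * \<bar>S i j\<bar>" by (metis abs_ge_self abs_mult)
      also have "\<dots> \<le> M * \<bar>S i j\<bar>" using gM that by (intro mult_right_mono) auto
      also have "\<dots> \<le> M / 2 * (r * S i i + S j j / r)"
        using mult_left_mono[OF psd_kernel_amgm[OF S that(3), of i j], of "M / 2"] M by simp
      finally show ?thesis .
    qed
    have mixed: "M / 2 * (t * S i i + S j j / t) \<le> h i + h j" if "i < k" "\<not> j < k" for i j
    proof -
      have "M / 2 * (t * S i i + S j j / t) = \<epsilon> / (2 * s) * S i i + M / (2 * t) * S j j"
        unfolding tM[symmetric] by (simp add: algebra_simps)
      also have "\<dots> \<le> h i + h j"
        using that mult_right_mono[OF D(2) pos[of j]] by (simp add: h_def)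
      finally show ?thesis .
    qed
    have termwise: "g i j * S i j \<le> (if i < k \<and> j < k then g i j * S i j else 0) + (h i + h j)"
      if ij: "i < s" "j < s" for i j
    proof -
      consider "i < k" "j < k" | "i < k" "\<not> j < k" | "\<not> i < k" "j < k" | "\<not> i < k" "\<not> j < k"
        by blast
      then show ?thesis
      proof cases
        case 1
        then show ?thesis using h[of i] h[of j] by simp
      next
        case 2
        then show ?thesis using gS[OF ij t] mixed[OF 2] by simp
      next
        case 3
        \<comment> \<open>The parameter \<open>1 / t\<close> exchanges the roles of \<open>i\<close>
          and \<open>j\<close>, which reduces this case to \<open>mixed\<close>; \<open>g\<close> is
          known to be symmetric only within the leading block.\<close>
        have "g i j * S i j \<le> M / 2 * (1 / t * S i i + S j j / (1 / t))"
          by (rule gS[OF ij]) (use t in simp)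
        also have "\<dots> = M / 2 * (t * S j j + S i i / t)"
          by (simp add: algebra_simps)
        also have "\<dots> \<le> h j + h i" by (rule mixed[OF 3(2,1)])
        finally show ?thesis using 3 by simp
      next
        case 4
        have "g i j * S i j \<le> M / 2 * S i i + M / 2 * S j j"
          using gS[OF ij, of 1] by (simp add: distrib_left)
        also have "\<dots> \<le> h i + h j"
          using 4 mult_right_mono[OF D(1) pos[of i]] mult_right_mono[OF D(1) pos[of j]]
          by (simp add: h_def)
        finally show ?thesis using 4 by simp
      qed
    qed
    have restrict: "(\<Sum>i<s. if i < k then f i else 0) = (\<Sum>i<k. f i)" for f :: "nat \<Rightarrow> real"
    proof -
      have "{..<s} \<inter> {i. i < k} = {..<k}" using k by auto
      then show ?thesis by (simp add: sum.If_cases)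
    qed
    have "(\<Sum>i<s. \<Sum>j<s. g i j * S i j) \<le>
        (\<Sum>i<s. \<Sum>j<s. (if i < k \<and> j < k then g i j * S i j else 0) + (h i + h j))"
      by (intro sum_mono termwise) auto
    also have "\<dots> = (\<Sum>i<s. \<Sum>j<s. if i < k \<and> j < k then g i j * S i j else 0) + 2 * s * (\<Sum>i<s. h i)"
      by (simp add: sum.distrib flip: sum_distrib_left)
    also have "(\<Sum>i<s. \<Sum>j<s. if i < k \<and> j < k then g i j * S i j else 0) =
        (\<Sum>i<s. if i < k then (\<Sum>j<s. if j < k then g i j * S i j else 0) else 0)"
      by (intro sum.cong refl) simp
    also have "\<dots> = (\<Sum>i<k. \<Sum>j<k. g i j * S i j)" unfolding restrict ..
    also have "(\<Sum>i<k. \<Sum>j<k. g i j * S i j) \<le> - \<epsilon> * (\<Sum>i<k. S i i)"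
      using eS[OF S] by (simp add: sum_negf)
    also have "(\<Sum>i<s. h i) = \<epsilon> / (2 * s) * (\<Sum>i<k. S i i) + D * (\<Sum>i\<in>{k..<s}. S i i)"
    proof -
      have "{..<s} = {..<k} \<union> {k..<s}" using k by auto
      then have "(\<Sum>i<s. h i) = (\<Sum>i<k. h i) + (\<Sum>i\<in>{k..<s}. h i)"
        by (simp add: sum.union_disjoint ivl_disj_int)
      then show ?thesis by (simp add: h_def sum_distrib_left)
    qed
    finally show ?thesis using s by (simp add: algebra_simps)
  qed
  then show ?thesis using D s by (intro exI[of _ "2 * s * D"]) auto
qed

section \<open>The energy estimate\<close>

text \<open>Tested with \<open>L = 0\<close> in dimension 1, where all brackets and all positive
  powers vanish and the method multiplies by \<open>\<alpha> 0\<close>. With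
  \<open>\<alpha> 0 = 1\<close>, the first term of the energy equality is exactly the energy of
  \<open>u\<close>.\<close>

lemma energy_coeffs_beta_0:
  assumes "energy_coeffs s \<alpha> \<beta> \<gamma>"
  shows "\<beta> 0 = (\<alpha> 0)\<^sup>2"
proof -
  define H where "H = (1\<^sub>m 1 :: real mat)"
  define L where "L = (0\<^sub>m 1 1 :: real mat)"
  define u where "u = vec 1 (\<lambda>_. 1 :: real)"
  have c: "H \<in> carrier_mat 1 1" "L \<in> carrier_mat 1 1" "u \<in> carrier_vec 1"
    by (simp_all add: H_def L_def u_def)
  have Z: "0\<^sub>m 1 1 *\<^sub>v v = 0\<^sub>v 1" if "v \<in> carrier_vec 1" for v :: "real vec"
    using that by (intro eq_vecI) (auto simp: scalar_prod_def)
  have nz: "v \<bullet> v > 0" if "v \<in> carrier_vec 1" "v \<noteq> 0\<^sub>v 1" for v :: "real vec"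
  proof -
    have "v $ 0 \<noteq> 0" using that by (auto simp: vec_eq_iff)
    moreover have "v \<bullet> v = (v $ 0)\<^sup>2"
      using that by (simp add: scalar_prod_def power2_eq_square)
    ultimately show ?thesis by simp
  qed
  have pd: "pos_def 1 H" using nz by (simp add: pos_def_def H_def)
  have zero: "transpose_mat L * H + H * L = 0\<^sub>m 1 1" by (rule eq_matI) (simp_all add: L_def H_def)
  have sn: "semi_negative 1 H L" unfolding semi_negative_def neg_semidef_def zero using c Z by simp
  have br: "bracket_H H L v w = 0" if "v \<in> carrier_vec 1" "w \<in> carrier_vec 1" for v w
    unfolding bracket_H_def zero Z[OF that(2)] using that by simp
  have pc: "(L ^\<^sub>m j) *\<^sub>v u \<in> carrier_vec 1" for j
    using c by (meson mult_mat_vec_carrier pow_carrier_mat)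
  have pow: "(L ^\<^sub>m j) *\<^sub>v u = (if j = 0 then u else 0\<^sub>v 1)" for j
  proof (cases j)
    case 0
    then show ?thesis using c by simp
  next
    case (Suc i)
    then show ?thesis using pow_mat_Suc_left[OF c(2,3), of i] Z[OF pc[of i]] Suc by (simp add: L_def)
  qed
  have sq: "(norm_H H v)\<^sup>2 = (v $ 0)\<^sup>2" if "v \<in> carrier_vec 1" for v
    unfolding norm_H_square[OF pd that] inner_H_sums[OF c(1) that that]
    by (simp add: H_def power2_eq_square)
  have R: "rk_op s \<alpha> 1 L *\<^sub>v u = vec 1 (\<lambda>_. \<alpha> 0)"
  proof -
    have "(\<Sum>k\<le>s. \<alpha> k * 1 ^ k * ((L ^\<^sub>m k) *\<^sub>v u) $ n) = (\<Sum>k\<le>s. if k = 0 then \<alpha> 0 else 0)" if "n < 1" for n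
      unfolding pow using that by (intro sum.cong refl) (auto simp: u_def)
    then show ?thesis unfolding rk_op_mult_vec[OF c(2,3)] by (intro eq_vecI) simp_all
  qed
  have "(norm_H H (rk_op s \<alpha> 1 L *\<^sub>v u))\<^sup>2 =
          (\<Sum>k\<le>s. \<beta> k * 1 ^ (2 * k) * (norm_H H ((L ^\<^sub>m k) *\<^sub>v u))\<^sup>2) +
          (\<Sum>i<s. \<Sum>j<s. \<gamma> i j * 1 ^ (i + j + 1) *
             bracket_H H L ((L ^\<^sub>m i) *\<^sub>v u) ((L ^\<^sub>m j) *\<^sub>v u))"
    by (rule assms[unfolded energy_coeffs_def, THEN conjunct2, rule_format]) (use pd sn c in simp_all)
  also have "\<dots> = (\<Sum>k\<le>s. if k = 0 then \<beta> k else 0)"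
    unfolding br[OF pc pc] sq[OF pc] mult_zero_right sum.neutral_const add_0_right
    unfolding pow by (intro sum.cong refl) (simp add: u_def)
  finally show ?thesis unfolding R sq[OF vec_carrier] by simp
qed

text \<open>The last condition on \<open>lam\<close> collects the errors relative to
  \<open>P k k\<close>: the sum of the \<open>\<bar>\<beta> j\<bar>\<close> pays for the terms with
  \<open>j > k\<close>, and \<open>2 * real s * C\<close> for the
  \<open>\<gamma>\<close>-sum.\<close>

lemma opnorm_H_rk_op_le_one:
  fixes \<beta> :: "nat \<Rightarrow> real"
  assumes E: "energy_coeffs s \<alpha> \<beta> \<gamma>" and \<beta>0: "\<beta> 0 = 1" and k: "leading_index s \<beta> k"
    and C: "C \<ge> 0" "\<And>S. psd_kernel S \<Longrightarrow>
      (\<Sum>i<s. \<Sum>j<s. \<gamma> i j * S i j) \<le> C * (\<Sum>i\<in>{k..<s}. S i i)"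
    and lam: "0 < lam" "lam \<le> 1" "\<beta> k + lam * ((\<Sum>j\<le>s. \<bar>\<beta> j\<bar>) + 2 * real s * C) \<le> 0"
    and H: "pos_def N H" and L: "semi_negative N H L" and \<tau>: "\<tau> > 0" "\<tau> * opnorm_H H L \<le> lam"
  shows "opnorm_H H (rk_op s \<alpha> \<tau> L) \<le> 1"
proof (rule opnorm_H_le_one[OF H])
  fix u :: "real vec" assume u: "u \<in> carrier_vec N"
  have Hc: "H \<in> carrier_mat N N" "transpose_mat H = H" and Lc: "L \<in> carrier_mat N N"
    using H L by (auto simp: pos_def_def semi_negative_def)
  define x where "x i = (L ^\<^sub>m i) *\<^sub>v u" for i
  have xc: "x i \<in> carrier_vec N" for i
    unfolding x_def using Lc u by (meson mult_mat_vec_carrier pow_carrier_mat)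
  have xS: "L *\<^sub>v x i = x (Suc i)" for i
    unfolding x_def using pow_mat_Suc_left[OF Lc u] by simp
  \<comment> \<open>The factor 1 gives \<open>P\<close> the shape required by
    \<open>psd_kernel_scale\<close>.\<close>
  define P where "P i j = 1 * (\<tau> ^ i * \<tau> ^ j * inner_H H (x i) (x j))" for i j
  define S where "S i j = \<tau> * (\<tau> ^ i * \<tau> ^ j * bracket_H H L (x i) (x j))" for i j
  have P: "psd_kernel P" unfolding P_def
    by (intro psd_kernel_scale psd_kernel_inner_H[OF H xc]) simp
  have S: "psd_kernel S" unfolding S_def
    by (intro psd_kernel_scale psd_kernel_bracket_H[OF Hc(1) L xc]) (use \<tau> in simp)
  have Pn: "P i i = \<tau> ^ (2 * i) * (norm_H H (x i))\<^sup>2" for i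
    unfolding norm_H_square[OF H xc] P_def by (simp add: mult_2 power_add)
  note P0 = psd_kernel_diag[OF P]
  have lam2: "lam\<^sup>2 \<le> lam" using lam by (simp add: power2_eq_square mult_left_le)
  have step: "P (Suc i) (Suc i) \<le> lam\<^sup>2 * P i i" for i
  proof -
    have n: "norm_H H (x j) \<ge> 0" for j using inner_H_nonneg[OF H xc] by (simp add: norm_H_def)
    have "\<tau> * norm_H H (x (Suc i)) \<le> \<tau> * (opnorm_H H L * norm_H H (x i))"
      using norm_H_mult_le_opnorm_H[OF H Lc xc, of i] \<tau> by (simp add: xS)
    also have "\<dots> \<le> lam * norm_H H (x i)"
      using mult_right_mono[OF \<tau>(2) n[of i]] by (simp add: mult.assoc)
    finally have "(\<tau> * norm_H H (x (Suc i)))\<^sup>2 \<le> (lam * norm_H H (x i))\<^sup>2"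
      using \<tau> n by (intro power_mono) auto
    then have "\<tau> ^ (2 * i) * (\<tau> * norm_H H (x (Suc i)))\<^sup>2 \<le> \<tau> ^ (2 * i) * (lam * norm_H H (x i))\<^sup>2"
      using \<tau> by (intro mult_left_mono) auto
    then show ?thesis unfolding Pn by (simp add: power_mult_distrib power2_eq_square ac_simps)
  qed
  have dec: "P (Suc i) (Suc i) \<le> lam * P i i" for i
    using step[of i] mult_right_mono[OF lam2 P0[of i]] by linarith
  have dec1: "P (Suc i) (Suc i) \<le> P i i" for i
    using dec[of i] mult_right_mono[OF lam(2) P0[of i]] by simp
  have mono: "P j j \<le> P i i" if "i \<le> j" for i j
    using that by (induction rule: dec_induct) (auto intro: order.trans[OF dec1])
  have tail: "P j j \<le> lam * P k k" if "k < j" for j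
    using mono[of "Suc k" j] dec[of k] that by simp
  \<comment> \<open>The bracket of an iterate with itself is -2 times its inner product with the
    next iterate. Young with parameter \<open>lam\<close> is balanced here because
    \<open>step\<close> gains \<open>lam\<^sup>2\<close>; hence one factor \<open>lam\<close>
    survives.\<close>
  have SP: "S i i \<le> 2 * lam * P i i" for i
  proof -
    have "S i i = - 2 * P i (Suc i)"
      unfolding S_def P_def bracket_H_eq[OF Hc(1) Lc xc xc] xS
        inner_H_commute[OF Hc xc xc, of "Suc i" i] by simp
    also have "\<dots> \<le> lam * P i i + P (Suc i) (Suc i) / lam"
      using psd_kernel_amgm[OF P lam(1), of i "Suc i"] by linarith
    also have "P (Suc i) (Suc i) / lam \<le> lam * P i i"
      using step[of i] lam(1) by (simp add: field_simps power2_eq_square)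
    finally show ?thesis by simp
  qed
  have sumS: "(\<Sum>i\<in>{k..<s}. S i i) \<le> 2 * s * (lam * P k k)"
  proof -
    have "(\<Sum>i\<in>{k..<s}. S i i) \<le> (\<Sum>i\<in>{k..<s}. 2 * lam * P k k)"
      using SP mono lam(1) by (intro sum_mono order.trans[OF SP] mult_left_mono) auto
    also have "\<dots> = real (s - k) * (2 * (lam * P k k))" by simp
    also have "\<dots> \<le> real s * (2 * (lam * P k k))"
      using P0[of k] lam(1) by (intro mult_right_mono) auto
    finally show ?thesis by simp
  qed
  \<comment> \<open>Indices strictly between 0 and \<open>k\<close> contribute nothing, as
    \<open>\<beta> j = 0\<close> there. The nonnegative error term is allotted to every
    \<open>j\<close> so that the bound can be summed uniformly.\<close>
  have termwise: "\<beta> j * P j j \<le> (if j = 0 then P 0 0 else 0) + (if j = k then \<beta> k * P k k else 0) +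
      \<bar>\<beta> j\<bar> * (lam * P k k)" for j
  proof -
    have r: "\<bar>\<beta> j\<bar> * (lam * P k k) \<ge> 0" using P0[of k] lam(1) by simp
    consider "j = 0" | "1 \<le> j" "j < k" | "j = k" | "k < j" by linarith
    then show ?thesis
    proof cases
      case 4
      have "\<beta> j * P j j \<le> \<bar>\<beta> j\<bar> * P j j" using P0[of j] by (intro mult_right_mono) auto
      also have "\<dots> \<le> \<bar>\<beta> j\<bar> * (lam * P k k)" using tail[OF 4] by (intro mult_left_mono) auto
      finally show ?thesis using 4 by simp
    qed (use k r \<beta>0 in \<open>auto simp: leading_index_def\<close>)
  qed
  have "(norm_H H (rk_op s \<alpha> \<tau> L *\<^sub>v u))\<^sup>2 =
          (\<Sum>k\<le>s. \<beta> k * \<tau> ^ (2 * k) * (norm_H H (x k))\<^sup>2) +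
          (\<Sum>i<s. \<Sum>j<s. \<gamma> i j * \<tau> ^ (i + j + 1) * bracket_H H L (x i) (x j))"
    using E[unfolded energy_coeffs_def] H L u \<tau> unfolding x_def by blast
  also have "\<dots> = (\<Sum>j\<le>s. \<beta> j * P j j) + (\<Sum>i<s. \<Sum>j<s. \<gamma> i j * S i j)"
    unfolding Pn S_def by (simp add: power_add ac_simps)
  also have "(\<Sum>i<s. \<Sum>j<s. \<gamma> i j * S i j) \<le> C * (\<Sum>i\<in>{k..<s}. S i i)" by (rule C(2)[OF S])
  also have "\<dots> \<le> C * (2 * s * (lam * P k k))" by (rule mult_left_mono[OF sumS C(1)])
  also have "(\<Sum>j\<le>s. \<beta> j * P j j) \<le> P 0 0 + \<beta> k * P k k + (\<Sum>j\<le>s. \<bar>\<beta> j\<bar>) * (lam * P k k)"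
  proof -
    have "(\<Sum>j\<le>s. \<beta> j * P j j) \<le> (\<Sum>j\<le>s. (if j = 0 then P 0 0 else 0) +
        (if j = k then \<beta> k * P k k else 0) + \<bar>\<beta> j\<bar> * (lam * P k k))"
      by (intro sum_mono termwise)
    also have "\<dots> = P 0 0 + \<beta> k * P k k + (\<Sum>j\<le>s. \<bar>\<beta> j\<bar>) * (lam * P k k)"
      using k by (simp add: sum.distrib sum_distrib_right leading_index_def)
    finally show ?thesis .
  qed
  finally have "(norm_H H (rk_op s \<alpha> \<tau> L *\<^sub>v u))\<^sup>2 \<le>
      P 0 0 + (\<beta> k + lam * ((\<Sum>j\<le>s. \<bar>\<beta> j\<bar>) + 2 * real s * C)) * P k k"
    by (simp add: algebra_simps)
  also have "\<dots> \<le> P 0 0" using lam(3) P0[of k] by (simp add: mult_nonpos_nonneg)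
  also have "\<dots> = (norm_H H u)\<^sup>2" unfolding Pn using Lc u by (simp add: x_def)
  finally show "norm_H H (rk_op s \<alpha> \<tau> L *\<^sub>v u) \<le> norm_H H u"
    by (rule power2_le_imp_le) (use inner_H_nonneg[OF H u] in \<open>simp add: norm_H_def\<close>)
qed

theorem theorem2p7:
  fixes s :: nat and \<alpha> \<beta> :: "nat \<Rightarrow> real" and \<gamma> :: "nat \<Rightarrow> nat \<Rightarrow> real" and k :: nat
  assumes "explicit_rk s \<alpha>"
    and "energy_coeffs s \<alpha> \<beta> \<gamma>"
    and "leading_index s \<beta> k"
    and "\<beta> k < 0"
    and "neg_def k (leading_submatrix k \<gamma>)"
  shows "\<exists>lam>0. \<forall>N H L \<tau>. pos_def N H \<longrightarrow> semi_negative N H L \<longrightarrow> \<tau> > 0 \<longrightarrow>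
           \<tau> * opnorm_H H L \<le> lam \<longrightarrow> opnorm_H H (rk_op s \<alpha> \<tau> L) \<le> 1"
proof -
  have "\<beta> 0 = 1" using energy_coeffs_beta_0[OF assms(2)] assms(1) by (simp add: explicit_rk_def)
  have "k \<le> s" using assms(3) by (simp add: leading_index_def)
  then obtain C where C: "C \<ge> 0" "\<And>S. psd_kernel S \<Longrightarrow>
      (\<Sum>i<s. \<Sum>j<s. \<gamma> i j * S i j) \<le> C * (\<Sum>i\<in>{k..<s}. S i i)"
    using psd_kernel_neg_def_block[OF _ assms(5)] by blast
  define K where "K = (\<Sum>j\<le>s. \<bar>\<beta> j\<bar>) + 2 * real s * C"
  have K: "K \<ge> 0" using C(1) by (simp add: K_def sum_nonneg)
  \<comment> \<open>The second entry gives \<open>lam * K \<le> - \<beta> k\<close>; using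
    \<open>K + 1\<close> keeps the denominator positive when only \<open>K \<ge> 0\<close> is
    known.\<close>
  define lam where "lam = min 1 (- \<beta> k / (K + 1))"
  have lam: "0 < lam" "lam \<le> 1" using K assms(4) by (auto simp: lam_def field_simps)
  have "lam * K \<le> lam * (K + 1)" using lam(1) by simp
  also have "\<dots> \<le> - \<beta> k / (K + 1) * (K + 1)"
    using K by (intro mult_right_mono) (auto simp: lam_def)
  also have "\<dots> = - \<beta> k" using K by simp
  finally have "\<beta> k + lam * K \<le> 0" by simp
  then show ?thesis
    using opnorm_H_rk_op_le_one[OF assms(2) \<open>\<beta> 0 = 1\<close> assms(3) C lam] lam(1)
    unfolding K_def by blast
qed

end
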